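(* Fix $p\ge n$, $\beta_0\in\mathbb{R}^p$ and $\lambda>0$, and let $y=X\beta_0+\varepsilon$, where $\varepsilon\in\mathbb{R}^n$ is random with i.i.d. components of mean zero and variance $\sigma^2$, such that $\varepsilon/\sqrt n$ has a density $g_n$ on $\mathbb{R}^n$. Suppose that every $\min(n,p)$ columns of $X$ are linearly independent, and that the block Lasso program with $\alpha=\infty$, $$\min_{\beta\in\mathbb{R}^p}\Big\{\frac1{2n}\|y-X\beta\|^2+\lambda\sum_{j=1}^Jw_j\|\beta_{(j)}\|_\infty\Big\},$$ has a unique solution for (Lebesgue) almost all $y\in\mathbb{R}^n$. Then the distribution of the augmented estimator $(\hat\beta,S)$, represented as $(\hat\gamma_{\mathcal A},\hat\beta_{\mathcal K^c},S,\mathcal A,\mathcal K)$, is given, for $(r_A,b_{K^c},s,A,K)\in\Omega$, by the $n$-form $$d\mu_{A,K}=\mathbb{P}(dr_A,db_{K^c},ds,\{A,K\})=f_{A,K}(r_A,b_{K^c},s)\,d\theta,$$ $$f_{A,K}(r_A,b_{K^c},s)=g_n\big(\tilde H_{A,K}(r_A,b_{K^c},s;\beta_0,\lambda)\big)\,|J_{A,K}(s;\lambda)|,\qquad\theta=(r_A,b_{K^c},s_F)\in\mathbb{R}^n.$$ Explicitly: for every $A$ with $|A|\le n$, every $K\in\mathscr K(A)$, every Borel $\Gamma\subset\prod_{j\in A}\mathcal C_j$, every set $\Phi_0$ of interior points of $\mathcal M_{A,K}$ parameterized by $s_F$ with inverse parameterization $s(\cdot)$, and every Borel $\Delta\subset\{s_F:s\in\Phi_0\}$,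 with $\Phi=\{s(u):u\in\Delta\}$, $$\mathbb{P}\{(\hat\gamma_A,\hat\beta_{K^c})\in\Gamma,\ S\in\Phi,\ \mathcal A=A,\ \mathcal K=K\}=\int_{\Gamma\times\Delta}f_{A,K}(r_A,b_{K^c},s(u))\,dr_A\,db_{K^c}\,du .$$
   Context: Setup. $X\in\mathbb{R}^{n\times p}$; $\{1,\dots,p\}$ is partitioned into nonempty groups $\mathcal{G}_1,\dots,\mathcal{G}_J$; $\mathcal{G}_A=\bigcup_{j\in A}\mathcal{G}_j$. For $v\in\mathbb{R}^p$, $v_{(j)}=(v_k)_{k\in\mathcal{G}_j}$ and $v_B=(v_k)_{k\in B}$; for a matrix $M$ with $p$ columns, $M_{(j)}$ and $M_B$ are the submatrices of the columns in $\mathcal{G}_j$ and $B$. Weights $w_j>0$; $W$ is the $p\times p$ diagonal matrix with entry $w_j$ at indices in $\mathcal{G}_j$. $\Psi=\frac1nX^{\mathsf T}X$; $M^+$ is the Moore–Penrose pseudo-inverse; $\mathrm{sgn}$ is applied componentwise with $\mathrm{sgn}(0)=0$. Augmented estimator. $\hat\beta$ is the block Lasso solution for $\alpha=\infty$ and the subgradient vector $S\in\mathbb{R}^p$ is defined by $\frac1nX^{\mathsf T}X\hat\beta+\lambda WS=\frac1nX^{\mathsf T}y$ (so $S_{(j)}\in\partial\|\cdot\|_\infty(\hat\beta_{(j)})$). Let $\hat\gamma_j=\|\hat\beta_{(j)}\|_\infty$, $\mathcal A=\{j:\hat\beta_{(j)}\ne0\}$, and for $j\in\mathcal A$, $\mathcal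 K_j=\{k\in\mathcal{G}_j:S_k\neq0\}$, $\mathcal K_j^c=\mathcal{G}_j\setminus\mathcal K_j$; $\mathcal K=\bigcup_{j\in\mathcal A}\mathcal K_j$, $\mathcal K^c=\bigcup_{j\in\mathcal A}\mathcal K_j^c$. For $j\in\mathcal A$, $\|S_{(j)}\|_1=1$ and $\hat\beta_{\mathcal K_j}=\hat\gamma_j\,\mathrm{sgn}(S_{\mathcal K_j})$; hence $(\hat\beta,S)$ is equivalently represented by $(\hat\gamma_{\mathcal A},\hat\beta_{\mathcal K^c},S,\mathcal A,\mathcal K)$. Sample space. For $A\subset\{1,\dots,J\}$ with $|A|\le n$, $\mathscr K(A)=\{K\subset\mathcal{G}_A:K\cap\mathcal{G}_j\ne\varnothing\ \forall j\in A,\ |\mathcal{G}_A\setminus K|\le n-|A|\}$. For $K\in\mathscr K(A)$ put $K^c=\mathcal{G}_A\setminus K$, $K_j=K\cap\mathcal{G}_j$, $K_j^c=K^c\cap\mathcal{G}_j$, $q=n-|A|-|K^c|$, $I=\{1,\dots,p\}\setminus K^c$, $\mathcal V=\mathrm{row}(XW^{-1})$ (row space), $\mathcal M_{A,K}=\{s\in\mathcal V:\|s_{K_j}\|_1=1,\ s_{K_j^c}=0\ \forall j\in A,\ \|s_{(j)}\|_1\le1\ \forall j\notin A\}$, $\mathcal C_j=\{(r_j,v)\in(0,\infty)\times\mathbb{R}^{|K_j^c|}:\|v\|_\infty\le r_j\}$ (the space of $(\hat\gamma_j,\hat\beta_{K_j^c})$), $\Omega_{A,K}=(\prod_{j\in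 A}\mathcal C_j)\times\mathcal M_{A,K}$, and $\Omega$ is the union of $\Omega_{A,K}\times\{(A,K)\}$ over all such $A$ and $K$. Parameterization. Interior points of $\mathcal M_{A,K}$ are those with $s_k\ne0$ for all $k\in K$ and $\|s_{(j)}\|_1<1$ for $j\notin A$. For $F\subset\{1,\dots,p\}$ with $|F|=q$, a relatively open set $\Phi_0$ of interior points of $\mathcal M_{A,K}$ is parameterized by $s_F$ if $s\mapsto s_F$ is injective on $\Phi_0$ with open image in $\mathbb{R}^q$ and its inverse $u\mapsto s(u)$ is $C^1$; $T\in\mathbb{R}^{(p-|K^c|)\times q}$ is the derivative matrix of $u\mapsto s(u)_I$, so $ds_I=T\,ds_F$. (If $q=0$, $\Phi_0$ is a point, $T$ is empty and integration over $\Delta$ is evaluation.) Mapping and Jacobian. For $(r_A,b_{K^c},s)\in\Omega_{A,K}$ let $b\in\mathbb{R}^p$ be given by $b_{(j)}=0$ for $j\notin A$, $b_{K_j}=r_j\,\mathrm{sgn}(s_{K_j})$ for $j\in A$, and the given $b_{K^c}$; then $\tilde H_{A,K}(r_A,b_{K^c},s;\beta_0,\lambda)=\sqrt n\,(X^{\mathsf T})^+(\Psi b+\lambda Ws-\Psi\beta_0)$. Let $\{\Psi\circ\mathrm{sgn}(s)\}_A$ be the $p\times|A|$ matrix with columns $\Psi_{(j)}\mathrm{sgn}(s_{(j)})$, $j\in A$; $M(s,A,K;\lambda)=[\{\Psi\circ\mathrm{sgn}(s)\}_A\mid\Psi_{K^c}\mid\lambda W_IT]\in\mathbb{R}^{p\times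 n}$; $J_{A,K}(s;\lambda)=\det[\sqrt n\,(X^{\mathsf T})^+M(s,A,K;\lambda)]$. *)

theory Defs
  imports "HOL-Probability.Probability"
begin

text \<open>
  A vector indexed by a subset \<open>B\<close> of a finite index type is represented by its extension by
  zero: \<open>\<real>\<^sup>B\<close> is the coordinate subspace \<^term>\<open>coord_space B\<close>, and \<open>v\<^sub>B\<close> is \<^term>\<open>restr B v\<close>.
  The dimensions \<open>n\<close>, \<open>p\<close> and the number of groups are the cardinalities of the types
  \<^typ>\<open>'n\<close>, \<^typ>\<open>'p\<close> and \<^typ>\<open>'j\<close>.
\<close>

definition restr :: "'a set \<Rightarrow> real ^ 'a \<Rightarrow> real ^ 'a" where
  "restr B v = (\<chi> k. if k \<in> B then v $ k else 0)"

definition coord_space :: "'a set \<Rightarrow> (real ^ 'a) set" where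
  "coord_space B = {v. \<forall>k. k \<notin> B \<longrightarrow> v $ k = 0}"

text \<open>
  Lebesgue measure of \<open>\<real>\<^sup>B\<close>, transported to \<^term>\<open>coord_space B\<close>; for \<open>B = {}\<close> it is the unit
  mass at \<open>0\<close>.
\<close>

definition lborel_on :: "'a set \<Rightarrow> (real ^ 'a::finite) measure" where
  "lborel_on B = distr (\<Pi>\<^sub>M k\<in>B. lborel) borel (\<lambda>u. \<chi> k. if k \<in> B then u k else 0)"

definition l1_on :: "'a set \<Rightarrow> real ^ 'a \<Rightarrow> real" where
  "l1_on B v = (\<Sum>k\<in>B. \<bar>v $ k\<bar>)"

definition sgn_vec :: "real ^ 'a \<Rightarrow> real ^ 'a" where
  "sgn_vec v = (\<chi> k. sgn (v $ k))"

text \<open>The Moore--Penrose pseudo-inverse, characterized by the four Penrose equations.\<close>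

definition pinv :: "real ^ 'b ^ 'a \<Rightarrow> real ^ 'a ^ 'b" where
  "pinv M = (THE N. M ** N ** M = M \<and> N ** M ** N = N \<and>
                    transpose (M ** N) = M ** N \<and> transpose (N ** M) = N ** M)"

definition columns_independent :: "real ^ 'p ^ 'n \<Rightarrow> 'p set \<Rightarrow> bool" where
  "columns_independent X B \<longleftrightarrow>
     inj_on (\<lambda>k. column k X) B \<and> independent ((\<lambda>k. column k X) ` B)"

definition grp :: "('j \<Rightarrow> 'p set) \<Rightarrow> 'p \<Rightarrow> 'j" where
  "grp G k = (THE j. k \<in> G j)"

definition weight_mat :: "('j::finite \<Rightarrow> 'p::finite set) \<Rightarrow> ('j \<Rightarrow> real) \<Rightarrow> real ^ 'p ^ 'p" where
  "weight_mat G w = (\<chi> k l. if k = l then w (grp G k) else 0)"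

definition Psi :: "real ^ 'p ^ 'n \<Rightarrow> real ^ 'p ^ 'p" where
  "Psi X = (1 / real CARD('n)) *\<^sub>R (transpose X ** X)"


subsection \<open>The block Lasso and its augmented estimator\<close>

definition block_lasso_objective ::
  "real ^ 'p ^ 'n \<Rightarrow> ('j::finite \<Rightarrow> 'p set) \<Rightarrow> ('j \<Rightarrow> real) \<Rightarrow> real \<Rightarrow> real ^ 'n \<Rightarrow> real ^ 'p \<Rightarrow> real" where
  "block_lasso_objective X G w lam y b =
     1 / (2 * real CARD('n)) * (norm (y - X *v b))\<^sup>2
       + lam * (\<Sum>j\<in>UNIV. w j * infnorm (restr (G j) b))"

definition block_lasso_solution ::
  "real ^ 'p ^ 'n \<Rightarrow> ('j::finite \<Rightarrow> 'p set) \<Rightarrow> ('j \<Rightarrow> real) \<Rightarrow> real \<Rightarrow> real ^ 'n \<Rightarrow> real ^ 'p \<Rightarrow> bool" where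
  "block_lasso_solution X G w lam y b \<longleftrightarrow>
     is_arg_min (block_lasso_objective X G w lam y) (\<lambda>_. True) b"

definition subgradient_eq ::
  "real ^ 'p ^ 'n \<Rightarrow> ('j::finite \<Rightarrow> 'p set) \<Rightarrow> ('j \<Rightarrow> real) \<Rightarrow> real \<Rightarrow> real ^ 'n
     \<Rightarrow> real ^ 'p \<Rightarrow> real ^ 'p \<Rightarrow> bool" where
  "subgradient_eq X G w lam y b S \<longleftrightarrow>
     Psi X *v b + lam *\<^sub>R (weight_mat G w *v S) = (1 / real CARD('n)) *\<^sub>R (transpose X *v y)"

definition group_norms :: "('j::finite \<Rightarrow> 'p::finite set) \<Rightarrow> real ^ 'p \<Rightarrow> real ^ 'j" where
  "group_norms G b = (\<chi> j. infnorm (restr (G j) b))"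

definition active_groups :: "('j::finite \<Rightarrow> 'p::finite set) \<Rightarrow> real ^ 'p \<Rightarrow> 'j set" where
  "active_groups G b = {j. restr (G j) b \<noteq> 0}"

definition active_K :: "('j::finite \<Rightarrow> 'p::finite set) \<Rightarrow> real ^ 'p \<Rightarrow> real ^ 'p \<Rightarrow> 'p set" where
  "active_K G b S = (\<Union>j\<in>active_groups G b. {k \<in> G j. S $ k \<noteq> 0})"


subsection \<open>The sample space\<close>

definition group_union :: "('j \<Rightarrow> 'p set) \<Rightarrow> 'j set \<Rightarrow> 'p set" where
  "group_union G A = (\<Union>j\<in>A. G j)"

text \<open>\<open>Kc G A K\<close> is the complement \<open>K\<^sup>c\<close> of \<open>K\<close> relative to the groups in \<open>A\<close>, not to all indices.\<close>

definition Kc :: "('j \<Rightarrow> 'p set) \<Rightarrow> 'j set \<Rightarrow> 'p set \<Rightarrow> 'p set" where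
  "Kc G A K = group_union G A - K"

text \<open>The argument \<open>n\<close> of \<open>K_family\<close> and \<open>free_dim\<close> is the sample size \<open>CARD('n)\<close>.\<close>

definition K_family :: "nat \<Rightarrow> ('j \<Rightarrow> 'p set) \<Rightarrow> 'j set \<Rightarrow> 'p set set" where
  "K_family n G A =
     {K. K \<subseteq> group_union G A \<and> (\<forall>j\<in>A. K \<inter> G j \<noteq> {}) \<and> card (group_union G A - K) \<le> n - card A}"

definition free_dim :: "nat \<Rightarrow> ('j \<Rightarrow> 'p set) \<Rightarrow> 'j set \<Rightarrow> 'p set \<Rightarrow> nat" where
  "free_dim n G A K = n - card A - card (Kc G A K)"

definition row_space_V :: "real ^ 'p ^ 'n \<Rightarrow> ('j::finite \<Rightarrow> 'p set) \<Rightarrow> ('j \<Rightarrow> real) \<Rightarrow> (real ^ 'p) set" where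
  "row_space_V X G w = span (rows (X ** matrix_inv (weight_mat G w)))"

definition M_set ::
  "real ^ 'p ^ 'n \<Rightarrow> ('j::finite \<Rightarrow> 'p set) \<Rightarrow> ('j \<Rightarrow> real) \<Rightarrow> 'j set \<Rightarrow> 'p set \<Rightarrow> (real ^ 'p) set" where
  "M_set X G w A K =
     {s \<in> row_space_V X G w.
        (\<forall>j\<in>A. l1_on (K \<inter> G j) s = 1 \<and> (\<forall>k \<in> Kc G A K \<inter> G j. s $ k = 0)) \<and>
        (\<forall>j. j \<notin> A \<longrightarrow> l1_on (G j) s \<le> 1)}"

definition M_interior ::
  "real ^ 'p ^ 'n \<Rightarrow> ('j::finite \<Rightarrow> 'p set) \<Rightarrow> ('j \<Rightarrow> real) \<Rightarrow> 'j set \<Rightarrow> 'p set \<Rightarrow> (real ^ 'p) set" where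
  "M_interior X G w A K =
     {s \<in> M_set X G w A K. (\<forall>k\<in>K. s $ k \<noteq> 0) \<and> (\<forall>j. j \<notin> A \<longrightarrow> l1_on (G j) s < 1)}"

text \<open>The product of the cones \<open>C\<^sub>j\<close>, \<open>j \<in> A\<close>, as a set of pairs \<open>(r\<^sub>A, b\<^sub>K\<^sub>c)\<close>.\<close>

definition cone_prod :: "('j::finite \<Rightarrow> 'p::finite set) \<Rightarrow> 'j set \<Rightarrow> 'p set \<Rightarrow> ((real ^ 'j) \<times> (real ^ 'p)) set" where
  "cone_prod G A K =
     {(r, b). r \<in> coord_space A \<and> b \<in> coord_space (Kc G A K) \<and>
        (\<forall>j\<in>A. r $ j > 0 \<and> infnorm (restr (Kc G A K \<inter> G j) b) \<le> r $ j)}"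


subsection \<open>Parameterizations\<close>

text \<open>
  \<open>s\<close> is continuously differentiable on \<open>U\<close>, a relatively open subset of \<open>\<real>\<^sup>F\<close>, with derivative
  matrix \<open>T\<close>.  Only the columns of \<open>T u\<close> with index in \<open>F\<close> are meaningful (and determined).
\<close>

definition C1_with_derivative ::
  "'p set \<Rightarrow> (real ^ 'p) set \<Rightarrow> (real ^ 'p \<Rightarrow> real ^ 'p) \<Rightarrow> (real ^ 'p \<Rightarrow> real ^ 'p ^ 'p) \<Rightarrow> bool" where
  "C1_with_derivative F U s T \<longleftrightarrow>
     (\<forall>u\<in>U. (s has_derivative (\<lambda>h. T u *v h)) (at u within coord_space F)) \<and>
     (\<forall>k\<in>F. continuous_on U (\<lambda>u. column k (T u)))"

text \<open>
  \<open>\<Phi>0\<close> is parameterized by \<open>s\<^sub>F\<close>, with inverse parameterization \<open>s\<close> and derivative matrix \<open>T\<close>.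
  The values of \<open>s\<close> and \<open>T\<close> outside the image of \<open>\<Phi>0\<close> are irrelevant.
\<close>

definition parameterized ::
  "real ^ 'p ^ 'n \<Rightarrow> ('j::finite \<Rightarrow> 'p set) \<Rightarrow> ('j \<Rightarrow> real) \<Rightarrow> 'j set \<Rightarrow> 'p set \<Rightarrow> 'p set
     \<Rightarrow> (real ^ 'p) set \<Rightarrow> (real ^ 'p \<Rightarrow> real ^ 'p) \<Rightarrow> (real ^ 'p \<Rightarrow> real ^ 'p ^ 'p) \<Rightarrow> bool" where
  "parameterized X G w A K F \<Phi>0 s T \<longleftrightarrow>
     card F = free_dim CARD('n) G A K \<and>
     \<Phi>0 \<subseteq> M_interior X G w A K \<and>
     openin (top_of_set (M_set X G w A K)) \<Phi>0 \<and>
     inj_on (restr F) \<Phi>0 \<and>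
     openin (top_of_set (coord_space F)) (restr F ` \<Phi>0) \<and>
     (\<forall>v\<in>\<Phi>0. s (restr F v) = v) \<and>
     C1_with_derivative F (restr F ` \<Phi>0) s T"


subsection \<open>The map, its Jacobian and the density\<close>

definition full_beta ::
  "('j::finite \<Rightarrow> 'p::finite set) \<Rightarrow> 'j set \<Rightarrow> 'p set \<Rightarrow> real ^ 'j \<Rightarrow> real ^ 'p \<Rightarrow> real ^ 'p \<Rightarrow> real ^ 'p" where
  "full_beta G A K r b s =
     (\<chi> k. if k \<in> K then r $ grp G k * sgn (s $ k)
           else if k \<in> Kc G A K then b $ k else 0)"

definition H_map ::
  "real ^ 'p ^ 'n \<Rightarrow> ('j::finite \<Rightarrow> 'p set) \<Rightarrow> ('j \<Rightarrow> real) \<Rightarrow> real \<Rightarrow> real ^ 'p \<Rightarrow> 'j set \<Rightarrow> 'p set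
     \<Rightarrow> real ^ 'j \<Rightarrow> real ^ 'p \<Rightarrow> real ^ 'p \<Rightarrow> real ^ 'n" where
  "H_map X G w lam beta0 A K r b s =
     sqrt (real CARD('n)) *\<^sub>R (pinv (transpose X) *v
       (Psi X *v full_beta G A K r b s + lam *\<^sub>R (weight_mat G w *v s) - Psi X *v beta0))"

text \<open>
  The columns of \<open>M(s, A, K; \<lambda>)\<close> are indexed by the disjoint sum of \<open>A\<close>, \<open>K\<^sup>c\<close> and \<open>F\<close>.
  The restriction to \<open>I = - K\<^sup>c\<close> keeps only the rows of \<open>T\<close> with index in \<open>I\<close>.
\<close>

definition M_column ::
  "real ^ 'p ^ 'n \<Rightarrow> ('j::finite \<Rightarrow> 'p set) \<Rightarrow> ('j \<Rightarrow> real) \<Rightarrow> real \<Rightarrow> 'j set \<Rightarrow> 'p set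
     \<Rightarrow> real ^ 'p \<Rightarrow> real ^ 'p ^ 'p \<Rightarrow> 'j + 'p + 'p \<Rightarrow> real ^ 'p" where
  "M_column X G w lam A K s T c =
     (case c of
        Inl j \<Rightarrow> Psi X *v restr (G j) (sgn_vec s)
      | Inr (Inl k) \<Rightarrow> column k (Psi X)
      | Inr (Inr k) \<Rightarrow> lam *\<^sub>R (weight_mat G w *v restr (- Kc G A K) (column k T)))"

text \<open>
  The map \<open>e\<close> enumerates the \<open>n\<close> column indices.  Another enumeration permutes the columns,
  so it changes the Jacobian by at most a sign and leaves the density below unchanged.
\<close>

definition M_mat ::
  "real ^ 'p ^ 'n \<Rightarrow> ('j::finite \<Rightarrow> 'p set) \<Rightarrow> ('j \<Rightarrow> real) \<Rightarrow> real \<Rightarrow> 'j set \<Rightarrow> 'p set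
     \<Rightarrow> ('n \<Rightarrow> 'j + 'p + 'p) \<Rightarrow> real ^ 'p \<Rightarrow> real ^ 'p ^ 'p \<Rightarrow> real ^ 'n ^ 'p" where
  "M_mat X G w lam A K e s T = (\<chi> i c. M_column X G w lam A K s T (e c) $ i)"

definition jacobian ::
  "real ^ 'p ^ 'n \<Rightarrow> ('j::finite \<Rightarrow> 'p set) \<Rightarrow> ('j \<Rightarrow> real) \<Rightarrow> real \<Rightarrow> 'j set \<Rightarrow> 'p set
     \<Rightarrow> ('n \<Rightarrow> 'j + 'p + 'p) \<Rightarrow> real ^ 'p \<Rightarrow> real ^ 'p ^ 'p \<Rightarrow> real" where
  "jacobian X G w lam A K e s T =
     det (sqrt (real CARD('n)) *\<^sub>R (pinv (transpose X) ** M_mat X G w lam A K e s T))"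

definition aug_density ::
  "(real ^ 'n \<Rightarrow> real) \<Rightarrow> real ^ 'p ^ 'n \<Rightarrow> ('j::finite \<Rightarrow> 'p set) \<Rightarrow> ('j \<Rightarrow> real) \<Rightarrow> real \<Rightarrow> real ^ 'p
     \<Rightarrow> 'j set \<Rightarrow> 'p set \<Rightarrow> ('n \<Rightarrow> 'j + 'p + 'p)
     \<Rightarrow> real ^ 'j \<Rightarrow> real ^ 'p \<Rightarrow> real ^ 'p \<Rightarrow> real ^ 'p ^ 'p \<Rightarrow> real" where
  "aug_density g X G w lam beta0 A K e r b s T =
     g (H_map X G w lam beta0 A K r b s) * \<bar>jacobian X G w lam A K e s T\<bar>"

end

theory Submission
  imports Defs
begin

text \<open>
  The KKT conditions say that \<open>b\<close> solves the block Lasso at \<open>z\<close> with subgradient \<open>s\<close> iff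
  \<open>\<Psi> b + \<lambda> W s = X\<^sup>T z / n\<close>, every group of \<open>s\<close> has \<open>\<ell>\<^sub>1\<close>-norm at most \<open>1\<close>, and \<open>s\<close> attains the
  group norms of \<open>b\<close>.  For a point of the sample space these conditions hold at
  \<open>z = X \<beta>\<^sub>0 + \<surd>n H(r, b, s)\<close>, so up to the null set of non-unique problems the event is the
  preimage under \<open>\<epsilon> / \<surd>n\<close> of the image of \<open>\<Gamma> \<times> \<Delta>\<close> under \<open>H\<close>, and the change of variables
  formula applies.  Injectivity is needed only where the Jacobian does not vanish, since the rest has a null
  image by Sard.  There it holds: monotonicity of the subdifferential makes \<open>s\<close> a function of \<open>z\<close>,
  and for fixed \<open>s\<close> the map is affine in \<open>(r, b)\<close> with linear part formed by columns of the Jacobian matrix.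
\<close>

text \<open>\<open>bhat\<close> and \<open>S\<close> are an arbitrary choice of solution and
  subgradient and are not assumed measurable, so the event is shown to lie only in the completion of
  \<open>P\<close>. For this reason images are never handled as exact sets: each is compared with a
  Borel set by two inclusions up to a null set. A second obstacle is that the form lives on a
  product of coordinate subspaces indexed by \<open>A\<close>, \<open>Kc G A K\<close> and
  \<open>F\<close>, while the change of variables formula needs a map of \<open>real ^ 'n\<close>
  into itself. The bijection \<open>e\<close> identifies the two spaces coordinate by coordinate and
  therefore preserves Lebesgue measure. The pseudo-inverse enters because any n columns of
  \<open>X\<close> span the whole space. So \<open>transpose X\<close> is injective,
  \<open>pinv (transpose X)\<close> is a left inverse of it, and H recovers the noise divided by
  sqrt n, which is the argument of \<open>g\<close>. The signs of \<open>s\<close> do not spoil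
  differentiability: at interior points the entries on \<open>K\<close> are nonzero, so their signs
  are locally constant and contribute no derivative.\<close>

section \<open>Change of variables on finite index types\<close>

text \<open>
  HOL-Analysis states the change of variables theorem for well-ordered index types only.  Every
  finite index type has a copy \<open>idx\<close> that carries an arbitrary well-order, and the theorem is
  transported along the copy.
\<close>

typedef 'a idx = "UNIV :: 'a set" by auto

lemma bij_Rep_idx: "bij (Rep_idx :: 'a idx \<Rightarrow> 'a)"
  by (metis (no_types, lifting) Abs_idx_inverse Rep_idx_inverse UNIV_I bijI')

instance idx :: (finite) finite
proof
  show "finite (UNIV :: 'a idx set)"
    using bij_Rep_idx[where 'a='a] by (metis finite bij_betw_finite)
qed

definition idx_rank :: "'a::finite idx \<Rightarrow> nat" where
  "idx_rank = (SOME f. inj f)"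

lemma inj_idx_rank: "inj (idx_rank :: 'a::finite idx \<Rightarrow> nat)"
  unfolding idx_rank_def
  using finite_imp_inj_to_nat_seg[OF finite_class.finite_UNIV] by (metis someI_ex[of inj])

instantiation idx :: (finite) wellorder
begin

definition "x \<le> y \<longleftrightarrow> idx_rank x \<le> idx_rank y"
definition "x < y \<longleftrightarrow> idx_rank x < idx_rank y"

instance
proof
  fix P :: "'a idx \<Rightarrow> bool" and a
  assume step: "\<And>x. (\<And>y. y < x \<Longrightarrow> P y) \<Longrightarrow> P x"
  show "P a"
    by (induction a rule: measure_induct_rule[where f=idx_rank]) (metis step less_idx_def)
qed (auto simp: less_eq_idx_def less_idx_def inj_eq[OF inj_idx_rank] dest: antisym)

end

text \<open>Conjugation by \<open>f\<close> is a sign-preserving bijection between the permutations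
  of the two index types, so the Leibniz sums agree term by term.\<close>

lemma det_reindex:
  fixes A :: "'a::comm_ring_1^'n^'n" and f :: "'m::finite \<Rightarrow> 'n"
  assumes f: "bij f"
  shows "det (\<chi> i j. A $ f i $ f j) = det A"
proof -
  let ?c = "\<lambda>p x. f (p (inv f x))"
  have bij: "bij_betw ?c {p. p permutes UNIV} {p. p permutes UNIV}"
    using bij_betw_permutations[of f UNIV UNIV] f by simp
  have "det A = (\<Sum>p | p permutes (UNIV::'m set).
      of_int (sign (?c p)) * (\<Prod>i\<in>UNIV. A $ i $ ?c p i))"
    unfolding det_def by (rule sum.reindex_bij_betw[OF bij, symmetric])
  also have "\<dots> = (\<Sum>p | p permutes (UNIV::'m set).
      of_int (sign p) * (\<Prod>i\<in>UNIV. A $ f i $ f (p i)))"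
  proof (rule sum.cong[OF refl])
    fix p :: "'m \<Rightarrow> 'm" assume "p \<in> {p. p permutes UNIV}"
    then have p: "p permutes UNIV" by simp
    have "map_permutation UNIV f p = ?c p"
      using f by (auto simp: map_permutation_def fun_eq_iff bij_def)
    then have "sign (?c p) = sign p"
      using sign_map_permutation[of f UNIV p] p f by (simp add: bij_def)
    moreover have "(\<Prod>i\<in>UNIV. A $ i $ ?c p i) = (\<Prod>i\<in>UNIV. A $ f i $ f (p i))"
      using prod.reindex_bij_betw[OF f, of "\<lambda>i. A $ i $ ?c p i"] f
      by (simp add: bij_def inv_f_f)
    ultimately show "of_int (sign (?c p)) * (\<Prod>i\<in>UNIV. A $ i $ ?c p i)
      = of_int (sign p) * (\<Prod>i\<in>UNIV. A $ f i $ f (p i))" by simp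
  qed
  finally show ?thesis by (simp add: det_def)
qed

text \<open>Since \<open>h\<close> is continuous on \<open>S\<close> only, it is replaced by its
  product with the indicator of \<open>S\<close>, which is Borel on the whole space. The factor with
  \<open>D\<close> removes the difference off \<open>S\<close>.\<close>

lemma borel_measurable_transformed_density:
  fixes h :: "'a::euclidean_space \<Rightarrow> 'b::euclidean_space" and f D :: "_ \<Rightarrow> real"
  assumes S: "S \<in> sets borel" and h: "continuous_on S h"
    and D: "(\<lambda>x. indicator S x * D x) \<in> borel_measurable borel"
    and f[measurable]: "f \<in> borel_measurable borel"
  shows "(\<lambda>x. ennreal (f (h x) * D x) * indicator S x) \<in> borel_measurable borel"
proof -
  have [measurable]: "(\<lambda>x. indicator S x *\<^sub>R h x) \<in> borel_measurable borel"
    using S h by (rule borel_measurable_continuous_on_indicator)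
  have "(\<lambda>x. f (indicator S x *\<^sub>R h x) * (indicator S x * D x)) \<in> borel_measurable borel"
    using D by measurable
  then have "(\<lambda>x. ennreal (f (indicator S x *\<^sub>R h x) * (indicator S x * D x))) \<in> borel_measurable borel"
    by simp
  also have "(\<lambda>x. ennreal (f (indicator S x *\<^sub>R h x) * (indicator S x * D x)))
      = (\<lambda>x. ennreal (f (h x) * D x) * indicator S x)"
    by (auto simp: indicator_def)
  finally show ?thesis .
qed

text \<open>The image of a Borel set is known only to be Lebesgue measurable, hence the Borel set
  \<open>B\<close> and the common null set \<open>N\<close>. Points with vanishing determinant
  contribute nothing on either side: their image is null, and so is their integrand.\<close>

lemma change_of_variables_wellorder:
  fixes h :: "real ^ 'm::{finite,wellorder} \<Rightarrow> real ^ 'm::_" and f :: "real ^ 'm::_ \<Rightarrow> real"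
  assumes S: "S \<in> sets borel"
    and der: "\<And>x. x \<in> S \<Longrightarrow> (h has_derivative (\<lambda>v. M x *v v)) (at x within S)"
    and detM: "(\<lambda>x. indicator S x * \<bar>det (M x)\<bar>) \<in> borel_measurable borel"
    and inj: "inj_on h {x \<in> S. det (M x) \<noteq> 0}"
    and f: "integrable lborel f" "\<And>x. f x \<ge> 0"
  shows "\<exists>B N. B \<in> sets borel \<and> N \<in> null_sets lborel \<and> h ` S \<subseteq> B \<union> N \<and> B \<subseteq> h ` S \<union> N \<and>
    (\<integral>\<^sup>+x. ennreal (f x) * indicator B x \<partial>lborel)
      = (\<integral>\<^sup>+x. ennreal (f (h x) * \<bar>det (M x)\<bar>) * indicator S x \<partial>lborel)"
proof -
  define D where "D = {x \<in> S. det (M x) \<noteq> 0}"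
  \<comment> \<open>\<open>D\<close> is Borel as the set where the function in \<open>detM\<close>
    is nonzero; \<open>M\<close> itself need not be measurable.\<close>
  have D_eq: "D = {x \<in> space borel. indicator S x * \<bar>det (M x)\<bar> \<noteq> 0}"
    by (auto simp: D_def indicator_def)
  have D: "D \<in> sets borel"
    unfolding D_eq using detM by measurable
  have DS: "D \<subseteq> S" by (auto simp: D_def)
  have derD: "(h has_derivative (\<lambda>v. M x *v v)) (at x within D)" if "x \<in> D" for x
    using der[of x] that DS by (meson has_derivative_subset subsetD)
  have fb[measurable]: "f \<in> borel_measurable borel"
    using borel_measurable_integrable[OF f(1)] by simp
  have hD: "h ` D \<in> sets lebesgue"
  proof (rule differentiable_image_in_sets_lebesgue)
    show "D \<in> sets lebesgue" using D by simp
    show "h differentiable_on D"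
      using derD unfolding differentiable_on_def differentiable_def by blast
  qed simp
  have neg: "negligible (h ` {x \<in> S. det (M x) = 0})"
  proof (rule baby_Sard)
    fix x assume x: "x \<in> {x \<in> S. det (M x) = 0}"
    show "(h has_derivative (\<lambda>v. M x *v v)) (at x within {x \<in> S. det (M x) = 0})"
      using der[of x] x by (metis (no_types, lifting) has_derivative_subset mem_Collect_eq subsetI)
    show "rank (matrix (\<lambda>v. M x *v v)) < CARD('m)"
      using x by (simp add: det_nz_iff_inj less_rank_noninjective matrix_of_matrix_vector_mul)
        (metis (no_types, lifting) det_nz_iff_inj matrix_of_matrix_vector_mul matrix_vector_mul_linear)
  qed simp
  \<comment> \<open>The Lebesgue measurable image splits into a Borel part and a subset of a Borel
    null set.\<close>
  obtain B N1 N2 where B: "h ` D = B \<union> N1" "N1 \<subseteq> N2" "N2 \<in> null_sets lborel" "B \<in> sets lborel"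
    using hD by (rule sets_completionE) auto
  obtain N3 where N3: "h ` {x \<in> S. det (M x) = 0} \<subseteq> N3" "N3 \<in> null_sets lborel"
    using neg unfolding negligible_iff_null_sets by (meson null_sets_completion_iff2)
  have fi: "f absolutely_integrable_on (h ` D)"
  proof -
    have "integrable lebesgue f"
      using f(1) by (simp add: integrable_completion)
    then show ?thesis
      unfolding set_integrable_def using hD by (intro integrable_mult_indicator)
  qed
  define b where "b = integral (h ` D) f"
  \<comment> \<open>The theorem applied here is about vector-valued integrands, so the scalar
    \<open>f\<close> is wrapped as a map into \<open>real^1\<close> and unwrapped
    afterwards.\<close>
  have "(\<lambda>x. \<bar>det (matrix (\<lambda>v. M x *v v))\<bar> *\<^sub>R (vec (f (h x)) :: real^1)) absolutely_integrable_on D \<and>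
     integral D (\<lambda>x. \<bar>det (matrix (\<lambda>v. M x *v v))\<bar> *\<^sub>R (vec (f (h x)) :: real^1)) = vec b"
  proof (subst has_absolute_integral_change_of_variables[OF _ derD])
    show "D \<in> sets lebesgue" using D by simp
    show "inj_on h D" using inj by (simp add: D_def)
    show "(\<lambda>x. vec (f x) :: real^1) absolutely_integrable_on h ` D \<and>
        integral (h ` D) (\<lambda>x. vec (f x)) = (vec b :: real^1)"
      using fi by (simp add: absolutely_integrable_on_1_iff integral_on_1_eq b_def)
  qed
  then have "(\<lambda>x. \<bar>det (M x)\<bar> * f (h x)) absolutely_integrable_on D"
    and "integral D (\<lambda>x. \<bar>det (M x)\<bar> * f (h x)) = b"
    by (simp_all add: absolutely_integrable_on_1_iff integral_on_1_eq matrix_of_matrix_vector_mul vec_eq_iff)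
  then have 1: "(\<integral>\<^sup>+x. ennreal (indicator D x * (\<bar>det (M x)\<bar> * f (h x))) \<partial>lebesgue) = ennreal b"
    using f(2)
    by (subst nn_integral_eq_integral)
      (auto simp: set_integrable_def set_lebesgue_integral_def simp flip: set_lebesgue_integral_eq_integral)
  have 2: "(\<integral>\<^sup>+x. ennreal (indicator (h ` D) x * f x) \<partial>lebesgue) = ennreal b"
    using f(2) fi unfolding b_def
    by (subst nn_integral_eq_integral)
      (auto simp: set_integrable_def set_lebesgue_integral_def simp flip: set_lebesgue_integral_eq_integral)
  have "(\<integral>\<^sup>+x. ennreal (f (h x) * \<bar>det (M x)\<bar>) * indicator S x \<partial>lborel) =
      (\<integral>\<^sup>+x. ennreal (f (h x) * \<bar>det (M x)\<bar>) * indicator S x \<partial>lebesgue)"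
    by (simp add: nn_integral_completion)
  also have "\<dots> = (\<integral>\<^sup>+x. ennreal (indicator D x * (\<bar>det (M x)\<bar> * f (h x))) \<partial>lebesgue)"
    by (rule nn_integral_cong) (auto simp: D_def indicator_def mult.commute)
  finally have 3: "(\<integral>\<^sup>+x. ennreal (f (h x) * \<bar>det (M x)\<bar>) * indicator S x \<partial>lborel) = ennreal b"
    using 1 by simp
  have "(\<integral>\<^sup>+x. ennreal (f x) * indicator B x \<partial>lborel) = (\<integral>\<^sup>+x. ennreal (f x) * indicator B x \<partial>lebesgue)"
    using B(4) by (subst nn_integral_completion) auto
  also have "\<dots> = (\<integral>\<^sup>+x. ennreal (indicator (h ` D) x * f x) \<partial>lebesgue)"
  proof (rule nn_integral_cong_AE)
    have "AE x in lborel. x \<notin> N2" using B(3) by (rule AE_not_in)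
    then have "AE x in lebesgue. x \<notin> N2" by (rule AE_completion)
    then show "AE x in lebesgue. ennreal (f x) * indicator B x = ennreal (indicator (h ` D) x * f x)"
      by eventually_elim (use B in \<open>auto simp: indicator_def\<close>)
  qed
  finally have 4: "(\<integral>\<^sup>+x. ennreal (f x) * indicator B x \<partial>lborel) = ennreal b"
    using 2 by simp
  have "h ` S = h ` D \<union> h ` {x \<in> S. det (M x) = 0}"
    by (auto simp: D_def)
  then have "h ` S \<subseteq> B \<union> (N2 \<union> N3)" "B \<subseteq> h ` S \<union> (N2 \<union> N3)"
    using B N3 by auto
  moreover have "N2 \<union> N3 \<in> null_sets lborel" using B(3) N3(2) by (rule null_sets.Un)
  ultimately show ?thesis using B(4) 3 4 by (intro exI[of _ B] exI[of _ "N2 \<union> N3"]) auto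
qed

lemma prod_Basis_cart:
  fixes g :: "real ^ 'n \<Rightarrow> 'b::comm_monoid_mult"
  shows "(\<Prod>b\<in>Basis. g b) = (\<Prod>i\<in>UNIV. g (axis i 1))"
proof -
  have B: "(Basis :: (real ^ 'n) set) = range (\<lambda>i. axis i 1)"
    by (auto simp: Basis_vec_def)
  have "inj (\<lambda>i::'n. axis i (1::real))"
    by (auto simp: inj_on_def axis_eq_axis)
  then show ?thesis unfolding B by (simp add: prod.reindex)
qed

lemma lborel_eqI_cart:
  fixes M :: "(real ^ 'n) measure"
  assumes "\<And>l u. (\<And>i. l $ i \<le> u $ i) \<Longrightarrow> emeasure M (box l u) = (\<Prod>i\<in>UNIV. ennreal (u $ i - l $ i))"
    and "sets M = sets borel"
  shows "lborel = M"
proof (rule lborel_eqI)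
  fix l u :: "real ^ 'n"
  assume "\<And>b. b \<in> Basis \<Longrightarrow> l \<bullet> b \<le> u \<bullet> b"
  then have "l \<bullet> axis i 1 \<le> u \<bullet> axis i 1" for i
    by (simp add: axis_in_Basis_iff)
  then have "l $ i \<le> u $ i" for i
    by (simp add: inner_axis)
  with assms(1) show "emeasure M (box l u) = ennreal (\<Prod>b\<in>Basis. (u - l) \<bullet> b)"
    by (simp add: prod_Basis_cart inner_axis prod_ennreal)
qed (fact assms(2))

lemma borel_measurable_reindex[measurable]:
  "(\<lambda>v :: real ^ 'n. (\<chi> i. v $ f i) :: real ^ 'm) \<in> borel_measurable borel"
  by (intro borel_measurable_continuous_onI continuous_intros)

text \<open>The preimage of a box is a box with the same side lengths in another order.\<close>

lemma distr_lborel_reindex: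
  fixes f :: "'m::finite \<Rightarrow> 'n::finite"
  assumes f: "bij f"
  shows "distr lborel borel (\<lambda>v :: real ^ 'n. (\<chi> i. v $ f i) :: real ^ 'm) = lborel"
proof (rule sym, rule lborel_eqI_cart)
  fix l u :: "real ^ 'm" assume lu: "\<And>i. l $ i \<le> u $ i"
  define l' u' :: "real ^ 'n" where "l' = (\<chi> i. l $ inv f i)" and "u' = (\<chi> i. u $ inv f i)"
  have "(\<lambda>v :: real ^ 'n. (\<chi> i. v $ f i) :: real ^ 'm) -` box l u = box l' u'"
  proof (intro set_eqI)
    fix v :: "real ^ 'n"
    have "(\<forall>i. l $ i < v $ f i \<and> v $ f i < u $ i) \<longleftrightarrow> (\<forall>k. l $ inv f k < v $ k \<and> v $ k < u $ inv f k)"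
      using f by (metis bij_inv_eq_iff)
    then show "v \<in> (\<lambda>v :: real ^ 'n. (\<chi> i. v $ f i) :: real ^ 'm) -` box l u \<longleftrightarrow> v \<in> box l' u'"
      by (simp add: mem_box_cart l'_def u'_def)
  qed
  moreover have "emeasure lborel (box l' u') = (\<Prod>i\<in>UNIV. ennreal (u' $ i - l' $ i))"
  proof (subst emeasure_lborel_box)
    show "l' \<bullet> b \<le> u' \<bullet> b" if "b \<in> Basis" for b
      using that lu by (auto simp: Basis_vec_def inner_axis l'_def u'_def)
    show "ennreal (prod ((\<bullet>) (u' - l')) Basis) = (\<Prod>i\<in>UNIV. ennreal (u' $ i - l' $ i))"
      using lu by (simp add: prod_Basis_cart inner_axis prod_ennreal l'_def u'_def)
  qed
  moreover have "(\<Prod>i\<in>UNIV. ennreal (u' $ i - l' $ i)) = (\<Prod>i\<in>UNIV. ennreal (u $ i - l $ i))"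
    using prod.reindex_bij_betw[OF f, of "\<lambda>i. ennreal (u' $ i - l' $ i)"] f
    by (simp add: l'_def u'_def bij_def inv_f_f)
  ultimately show "emeasure (distr lborel borel (\<lambda>v :: real ^ 'n. (\<chi> i. v $ f i) :: real ^ 'm)) (box l u)
      = (\<Prod>i\<in>UNIV. ennreal (u $ i - l $ i))"
    by (simp add: emeasure_distr)
qed simp

text \<open>Relabelling coordinates by \<open>p\<close> and its inverse \<open>q\<close> preserves
  Lebesgue measure and, by \<open>det_reindex\<close>, determinants. The well-ordered case is
  applied to the conjugate of \<open>h\<close>, and \<open>B\<close> and \<open>N\<close> are pulled
  back along \<open>p\<close>.\<close>

lemma change_of_variables_image:
  fixes h :: "real ^ 'n \<Rightarrow> real ^ 'n" and f :: "real ^ 'n \<Rightarrow> real"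
  assumes S: "S \<in> sets borel"
    and der: "\<And>x. x \<in> S \<Longrightarrow> (h has_derivative (\<lambda>v. M x *v v)) (at x within S)"
    and detM: "(\<lambda>x. indicator S x * \<bar>det (M x)\<bar>) \<in> borel_measurable borel"
    and inj: "inj_on h {x \<in> S. det (M x) \<noteq> 0}"
    and f: "integrable lborel f" "\<And>x. f x \<ge> 0"
  shows "\<exists>B N. B \<in> sets borel \<and> N \<in> null_sets lborel \<and> h ` S \<subseteq> B \<union> N \<and> B \<subseteq> h ` S \<union> N \<and>
    (\<integral>\<^sup>+x. ennreal (f x) * indicator B x \<partial>lborel)
      = (\<integral>\<^sup>+x. ennreal (f (h x) * \<bar>det (M x)\<bar>) * indicator S x \<partial>lborel)"
proof -
  define p :: "real ^ 'n \<Rightarrow> real ^ 'n idx" where "p v = (\<chi> i. v $ Rep_idx i)" for v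
  define q :: "real ^ 'n idx \<Rightarrow> real ^ 'n" where "q v = (\<chi> i. v $ Abs_idx i)" for v
  have bij_Abs: "bij (Abs_idx :: 'n \<Rightarrow> 'n idx)"
    by (metis (no_types, lifting) Abs_idx_inverse Rep_idx_inverse UNIV_I bijI')
  have pq[simp]: "p (q w) = w" "q (p v) = v" for v w
    by (simp_all add: p_def q_def Rep_idx_inverse Abs_idx_inverse)
  have lin: "bounded_linear p" "bounded_linear q"
    unfolding p_def[abs_def] q_def[abs_def] by (auto intro!: linear_conv_bounded_linear[THEN iffD1] linearI simp: vec_eq_iff)
  have pm[measurable]: "p \<in> borel_measurable borel" and qm[measurable]: "q \<in> borel_measurable borel"
    unfolding p_def q_def by measurable
  have distr_p: "distr lborel borel p = lborel" and distr_q: "distr lborel borel q = lborel"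
    unfolding p_def q_def by (rule distr_lborel_reindex[OF bij_Rep_idx] distr_lborel_reindex[OF bij_Abs])+
  define S' where "S' = q -` S"
  define h' where "h' w = p (h (q w))" for w
  define M' where "M' w = (\<chi> i j. M (q w) $ Rep_idx i $ Rep_idx j)" for w
  have S'_q: "q ` S' = S"
    unfolding S'_def using pq(2) by (metis surj_image_vimage_eq surj_def)
  have det': "det (M' w) = det (M (q w))" for w
    unfolding M'_def by (rule det_reindex[OF bij_Rep_idx])
  have M': "M' w *v v = p (M (q w) *v q v)" for w v
  proof -
    have "(M' w *v v) $ i = p (M (q w) *v q v) $ i" for i
      using sum.reindex_bij_betw[OF bij_Rep_idx[where 'a='n], of "\<lambda>j. M (q w) $ Rep_idx i $ j * q v $ j"]
      by (simp add: p_def matrix_vector_mult_def M'_def q_def Rep_idx_inverse)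
    then show ?thesis by (simp add: vec_eq_iff)
  qed
  have "\<exists>B N. B \<in> sets borel \<and> N \<in> null_sets lborel \<and> h' ` S' \<subseteq> B \<union> N \<and> B \<subseteq> h' ` S' \<union> N \<and>
    (\<integral>\<^sup>+x. ennreal (f (q x)) * indicator B x \<partial>lborel)
      = (\<integral>\<^sup>+x. ennreal (f (q (h' x)) * \<bar>det (M' x)\<bar>) * indicator S' x \<partial>lborel)"
  proof (rule change_of_variables_wellorder)
    show "S' \<in> sets borel"
      unfolding S'_def using measurable_sets[OF qm S] by simp
    show "(h' has_derivative (\<lambda>v. M' x *v v)) (at x within S')" if x: "x \<in> S'" for x
    proof -
      have "(q has_derivative q) (at x within S')"
        using lin(2) by (rule bounded_linear_imp_has_derivative)
      moreover have "(h has_derivative (\<lambda>v. M (q x) *v v)) (at (q x) within q ` S')"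
        using der[of "q x"] x unfolding S'_q by (simp add: S'_def)
      ultimately have "(h \<circ> q has_derivative (\<lambda>v. M (q x) *v v) \<circ> q) (at x within S')"
        by (rule diff_chain_within)
      from bounded_linear.has_derivative[OF lin(1) this]
      show ?thesis by (simp add: M' h'_def[abs_def] o_def)
    qed
    have "(\<lambda>x. indicator S (q x) * \<bar>det (M (q x))\<bar>) \<in> borel_measurable borel"
      using measurable_compose[OF qm detM] .
    then show "(\<lambda>x. indicator S' x * \<bar>det (M' x)\<bar>) \<in> borel_measurable borel"
      by (simp add: det' S'_def indicator_def)
    show "inj_on h' {x \<in> S'. det (M' x) \<noteq> 0}"
    proof (rule inj_onI)
      fix x y assume x: "x \<in> {x \<in> S'. det (M' x) \<noteq> 0}" and y: "y \<in> {x \<in> S'. det (M' x) \<noteq> 0}"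
        and eq: "h' x = h' y"
      from eq have "h (q x) = h (q y)" by (metis h'_def pq(2))
      with x y inj have "q x = q y" by (auto simp: S'_def det' inj_on_def)
      then show "x = y" by (metis pq(1))
    qed
    show "integrable lborel (\<lambda>x. f (q x))"
      using integrable_distr[of q lborel borel f] f(1) distr_q by simp
  qed (use f in auto)
  then obtain B N where B: "B \<in> sets borel" and N: "N \<in> null_sets lborel"
    and sub: "h' ` S' \<subseteq> B \<union> N" "B \<subseteq> h' ` S' \<union> N"
    and eq: "(\<integral>\<^sup>+x. ennreal (f (q x)) * indicator B x \<partial>lborel)
      = (\<integral>\<^sup>+x. ennreal (f (q (h' x)) * \<bar>det (M' x)\<bar>) * indicator S' x \<partial>lborel)"
    by blast
  have fm[measurable]: "f \<in> borel_measurable borel"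
    using borel_measurable_integrable[OF f(1)] by simp
  have hcont: "continuous_on S h"
    using der by (meson differentiable_imp_continuous_on differentiable_on_def differentiable_def)
  have m1: "(\<lambda>x. ennreal (f (h x) * \<bar>det (M x)\<bar>) * indicator S x) \<in> borel_measurable borel"
    using borel_measurable_transformed_density[OF S hcont detM fm] .
  have pB: "p -` B \<in> sets borel" using measurable_sets[OF pm B] by simp
  have Nb: "N \<in> sets borel" and N0: "emeasure lborel N = 0" using N by (auto simp: null_sets_def)
  have "emeasure lborel (p -` N) = 0"
    using N0 Nb emeasure_distr[of p lborel borel N] distr_p by simp
  then have pN: "p -` N \<in> null_sets lborel"
    using measurable_sets[OF pm Nb] by (simp add: null_sets_def)
  have h'_mem: "h' ` S' = p ` (h ` S)"
    unfolding S'_q[symmetric] by (auto simp: h'_def[abs_def] image_image)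
  have "h ` S \<subseteq> p -` B \<union> p -` N"
    using sub(1) unfolding h'_mem by auto
  moreover have "p -` B \<subseteq> h ` S \<union> p -` N"
  proof
    fix x assume "x \<in> p -` B"
    then consider "p x \<in> N" | z where "z \<in> h ` S" "p x = p z"
      using sub(2) unfolding h'_mem by (metis UnE imageE subsetD vimageE)
    then show "x \<in> h ` S \<union> p -` N"
      by cases (use pq(2) in \<open>metis UnI1 UnI2 vimageI2\<close>)+
  qed
  moreover have "(\<integral>\<^sup>+x. ennreal (f x) * indicator (p -` B) x \<partial>lborel)
      = (\<integral>\<^sup>+x. ennreal (f (h x) * \<bar>det (M x)\<bar>) * indicator S x \<partial>lborel)"
  proof -
    have "(\<integral>\<^sup>+x. ennreal (f x) * indicator (p -` B) x \<partial>lborel)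
        = (\<integral>\<^sup>+x. ennreal (f x) * indicator (p -` B) x \<partial>distr lborel borel q)"
      by (simp add: distr_q)
    also have "\<dots> = (\<integral>\<^sup>+x. ennreal (f (q x)) * indicator (p -` B) (q x) \<partial>lborel)"
      using pB by (intro nn_integral_distr) (auto intro!: borel_measurable_times_ennreal)
    also have "\<dots> = (\<integral>\<^sup>+x. ennreal (f (q x)) * indicator B x \<partial>lborel)"
      by (simp add: indicator_vimage)
    also note eq
    also have "(\<integral>\<^sup>+x. ennreal (f (q (h' x)) * \<bar>det (M' x)\<bar>) * indicator S' x \<partial>lborel)
        = (\<integral>\<^sup>+x. ennreal (f (h (q x)) * \<bar>det (M (q x))\<bar>) * indicator S (q x) \<partial>lborel)"
      by (simp add: h'_def det' S'_def indicator_def)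
    also have "\<dots> = (\<integral>\<^sup>+x. ennreal (f (h x) * \<bar>det (M x)\<bar>) * indicator S x \<partial>distr lborel borel q)"
      using m1 by (subst nn_integral_distr) auto
    finally show ?thesis by (simp add: distr_q)
  qed
  ultimately show ?thesis
    using pB pN by blast
qed

section \<open>Lebesgue measure on coordinate subspaces\<close>

lemma borel_measurable_vec_component[measurable]:
  "(\<lambda>v :: real ^ 'n. v $ i) \<in> borel_measurable borel"
  by (intro borel_measurable_continuous_onI continuous_intros)

lemma borel_measurable_vec_lambda:
  fixes f :: "'a \<Rightarrow> 'n::finite \<Rightarrow> real"
  assumes "\<And>i. (\<lambda>x. f x i) \<in> borel_measurable M"
  shows "(\<lambda>x. \<chi> i. f x i) \<in> borel_measurable M"
proof (rule borel_measurable_euclidean_space[THEN iffD2], rule ballI)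
  fix b :: "real ^ 'n" assume "b \<in> Basis"
  then obtain i where "b = axis i 1" by (auto simp: Basis_vec_def)
  then show "(\<lambda>x. (\<chi> i. f x i) \<bullet> b) \<in> borel_measurable M"
    using assms by (simp add: inner_axis)
qed

lemma measurable_coord_embedding:
  fixes B :: "'a::finite set"
  shows "(\<lambda>u. (\<chi> k. if k \<in> B then u k else 0) :: real ^ 'a) \<in> borel_measurable (\<Pi>\<^sub>M k\<in>B. lborel)"
proof (rule borel_measurable_vec_lambda)
  fix i
  show "(\<lambda>u. if i \<in> B then u i else 0) \<in> borel_measurable (\<Pi>\<^sub>M k\<in>B. lborel :: real measure)"
    by (cases "i \<in> B") (auto intro!: measurable_component_singleton)
qed

lemma sets_lborel_on[simp, measurable_cong]: "sets (lborel_on B) = sets borel"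
  and space_lborel_on[simp]: "space (lborel_on B) = UNIV"
  by (simp_all add: lborel_on_def)

text \<open>The set is a cylinder that leaves the coordinates outside \<open>B\<close> free. They
  carry no mass away from zero, so the value is a product over \<open>B\<close> alone, equal to one
  for empty \<open>B\<close>.\<close>

lemma emeasure_lborel_on_box:
  fixes B :: "'a::finite set"
  assumes "\<And>k. k \<in> B \<Longrightarrow> a k \<le> b k"
  shows "emeasure (lborel_on B) {v. \<forall>k\<in>B. a k < v $ k \<and> v $ k < b k} = (\<Prod>k\<in>B. ennreal (b k - a k))"
proof -
  interpret product_sigma_finite "\<lambda>_. lborel :: real measure" ..
  have m: "{v :: real ^ 'a. \<forall>k\<in>B. a k < v $ k \<and> v $ k < b k} \<in> sets borel"
    by measurable
  have "emeasure (lborel_on B) {v. \<forall>k\<in>B. a k < v $ k \<and> v $ k < b k}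
      = emeasure (\<Pi>\<^sub>M k\<in>B. lborel) (\<Pi>\<^sub>E k\<in>B. {a k<..<b k})"
    unfolding lborel_on_def
    by (subst emeasure_distr[OF measurable_coord_embedding m], rule arg_cong[where f="emeasure _"])
      (auto simp: space_PiM PiE_def Pi_def)
  also have "\<dots> = (\<Prod>k\<in>B. emeasure lborel {a k<..<b k})"
    by (rule emeasure_PiM) auto
  also have "\<dots> = (\<Prod>k\<in>B. ennreal (b k - a k))"
    using assms by (intro prod.cong) auto
  finally show ?thesis .
qed

lemma sigma_finite_lborel_on: "sigma_finite_measure (lborel_on (B :: 'a::finite set))"
proof
  let ?C = "\<lambda>n::nat. {v :: real ^ 'a. \<forall>k\<in>B. - real n < v $ k \<and> v $ k < real n}"
  have "(\<Union>n. ?C n) = UNIV"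
  proof (intro equalityI subsetI UNIV_I)
    fix v :: "real ^ 'a"
    obtain n where n: "norm v < real n" using reals_Archimedean2 by blast
    have "\<bar>v $ k\<bar> < real n" for k
      using component_le_norm_cart[of v k] n by linarith
    then have "v \<in> ?C n" by (auto simp: abs_less_iff minus_less_iff)
    then show "v \<in> (\<Union>n. ?C n)" by blast
  qed
  moreover have "emeasure (lborel_on B) (?C n) \<noteq> \<infinity>" for n
    by (subst emeasure_lborel_on_box) (auto simp: power_eq_top_ennreal)
  moreover have "?C n \<in> sets (lborel_on B)" for n
    by simp
  ultimately show "\<exists>A. countable A \<and> A \<subseteq> sets (lborel_on B) \<and> \<Union>A = space (lborel_on B)
      \<and> (\<forall>a\<in>A. emeasure (lborel_on B) a \<noteq> \<infinity>)"
    by (intro exI[of _ "range ?C"]) auto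
qed

lemma closed_coord_space: "closed (coord_space B)"
  unfolding coord_space_def by (intro closed_Collect_all closed_Collect_imp closed_Collect_eq) (auto intro!: continuous_intros)

lemma borel_coord_space[measurable]: "coord_space (B :: 'a::finite set) \<in> sets borel"
  by (simp add: closed_coord_space borel_closed)

text \<open>\<open>lborel_on B\<close> is a measure on all of \<open>real ^ 'a\<close>; this records
  that it is concentrated on the coordinate subspace.\<close>

lemma AE_lborel_on: "AE v in lborel_on (B :: 'a::finite set). v \<in> coord_space B"
  unfolding lborel_on_def
  by (subst AE_distr_iff[OF measurable_coord_embedding]) (auto simp: coord_space_def)

section \<open>Identification of the three coordinate blocks with \<open>real ^ 'n\<close>\<close>

definition join_coords ::
  "('n \<Rightarrow> 'j + 'p + 'p) \<Rightarrow> ((real ^ 'j) \<times> (real ^ 'p)) \<times> (real ^ 'p) \<Rightarrow> real ^ 'n" where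
  "join_coords e x = (\<chi> i. case e i of Inl j \<Rightarrow> fst (fst x) $ j
     | Inr (Inl k) \<Rightarrow> snd (fst x) $ k | Inr (Inr k) \<Rightarrow> snd x $ k)"

text \<open>The inverse of \<open>join_coords\<close> on the coordinate subspaces. The case
  distinctions matter: outside the index sets \<open>inv e\<close> is applied to points outside the
  range of \<open>e\<close>, where its value is arbitrary.\<close>

definition split_coords ::
  "('n \<Rightarrow> 'j + 'p + 'p) \<Rightarrow> 'j set \<Rightarrow> 'p set \<Rightarrow> 'p set \<Rightarrow> real ^ 'n
     \<Rightarrow> ((real ^ 'j) \<times> (real ^ 'p)) \<times> (real ^ 'p)" where
  "split_coords e A C F v =
     ((\<chi> j. if j \<in> A then v $ inv e (Inl j) else 0,
       \<chi> k. if k \<in> C then v $ inv e (Inr (Inl k)) else 0),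
      \<chi> k. if k \<in> F then v $ inv e (Inr (Inr k)) else 0)"

lemma bij_Plus_inv:
  assumes "bij_betw e UNIV (A <+> (C <+> F))"
  shows "j \<in> A \<Longrightarrow> e (inv e (Inl j)) = Inl j"
    and "k \<in> C \<Longrightarrow> e (inv e (Inr (Inl k))) = Inr (Inl k)"
    and "k \<in> F \<Longrightarrow> e (inv e (Inr (Inr k))) = Inr (Inr k)"
  using assms by (auto intro!: f_inv_into_f simp: bij_betw_def)

lemma split_join_coords:
  assumes "bij_betw e UNIV (A <+> (C <+> F))" "r \<in> coord_space A" "b \<in> coord_space C" "u \<in> coord_space F"
  shows "split_coords e A C F (join_coords e ((r, b), u)) = ((r, b), u)"
  using assms(2-4) by (auto simp: split_coords_def join_coords_def vec_eq_iff bij_Plus_inv[OF assms(1)] coord_space_def)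

lemma borel_measurable_join_coords[measurable]: "join_coords e \<in> borel_measurable borel"
  unfolding join_coords_def
proof (rule borel_measurable_vec_lambda)
  fix i
  show "(\<lambda>x :: ((real ^ 'a) \<times> (real ^ 'b)) \<times> (real ^ 'b). case e i of Inl j \<Rightarrow> fst (fst x) $ j
     | Inr (Inl k) \<Rightarrow> snd (fst x) $ k | Inr (Inr k) \<Rightarrow> snd x $ k) \<in> borel_measurable borel"
  proof -
    consider j where "e i = Inl j" | k where "e i = Inr (Inl k)" | k where "e i = Inr (Inr k)"
      by (metis sum.exhaust)
    then show ?thesis
      by cases (auto intro!: borel_measurable_continuous_onI continuous_intros)
  qed
qed

lemma borel_measurable_split_coords[measurable]: "split_coords e A C F \<in> borel_measurable borel"
proof -
  have "(\<lambda>v. split_coords e A C F v) \<in> borel_measurable borel"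
    unfolding split_coords_def borel_prod[symmetric]
    by (intro measurable_Pair borel_measurable_vec_lambda) auto
  then show ?thesis by simp
qed

text \<open>Stated for a general commutative monoid because it is needed twice: for products, to
  compute box volumes, and for sums, to expand a matrix-vector product by columns.\<close>

lemma (in comm_monoid_set) Plus_betw:
  fixes e :: "'n::finite \<Rightarrow> 'j + 'p + 'p"
  assumes e: "bij_betw e UNIV (A <+> (C <+> D))" and fin: "finite A" "finite C" "finite D"
  shows "F g UNIV = f (f (F (\<lambda>j. g (inv e (Inl j))) A) (F (\<lambda>k. g (inv e (Inr (Inl k)))) C))
    (F (\<lambda>k. g (inv e (Inr (Inr k)))) D)"
proof -
  have "F g UNIV = F (\<lambda>c. g (inv e c)) (A <+> (C <+> D))"
    using reindex_bij_betw[OF e, of "\<lambda>c. g (inv e c)"] e by (simp add: bij_betw_def inv_f_f)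
  also have "\<dots> = f (F (\<lambda>j. g (inv e (Inl j))) A) (F (\<lambda>c. g (inv e (Inr c))) (C <+> D))"
    using fin by (simp add: Plus)
  finally show ?thesis using fin by (simp add: Plus assoc)
qed

text \<open>Lebesgue measure is determined by boxes, and a box pulls back to a product of three
  cylinders, one for each block.\<close>

lemma distr_join_coords:
  fixes A :: "'j::finite set" and C F :: "'p::finite set" and e :: "'n::finite \<Rightarrow> 'j + 'p + 'p"
  assumes e: "bij_betw e UNIV (A <+> (C <+> F))"
  shows "distr ((lborel_on A \<Otimes>\<^sub>M lborel_on C) \<Otimes>\<^sub>M lborel_on F) borel (join_coords e) = lborel"
    (is "distr ?N _ _ = _")
proof (rule sym, rule lborel_eqI_cart)
  fix l u :: "real ^ 'n" assume lu: "\<And>i. l $ i \<le> u $ i"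
  interpret F: sigma_finite_measure "lborel_on F" by (rule sigma_finite_lborel_on)
  interpret C: sigma_finite_measure "lborel_on C" by (rule sigma_finite_lborel_on)
  let ?BA = "{v. \<forall>k\<in>A. l $ inv e (Inl k) < v $ k \<and> v $ k < u $ inv e (Inl k)}"
  let ?BC = "{v. \<forall>k\<in>C. l $ inv e (Inr (Inl k)) < v $ k \<and> v $ k < u $ inv e (Inr (Inl k))}"
  let ?BF = "{v. \<forall>k\<in>F. l $ inv e (Inr (Inr k)) < v $ k \<and> v $ k < u $ inv e (Inr (Inr k))}"
  have all_UNIV: "(\<forall>i. P i) \<longleftrightarrow> (\<forall>j\<in>A. P (inv e (Inl j))) \<and> (\<forall>k\<in>C. P (inv e (Inr (Inl k)))) \<and>
      (\<forall>k\<in>F. P (inv e (Inr (Inr k))))" for P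
  proof -
    have "(\<forall>i. P i) \<longleftrightarrow> (\<forall>c\<in>A <+> (C <+> F). P (inv e c))"
      using e by (metis UNIV_I bij_betw_def inv_f_f image_iff rangeI)
    then show ?thesis by auto
  qed
  have sets: "sets ?N = sets borel"
    by (simp add: borel_prod[symmetric] cong: sets_pair_measure_cong)
  have "join_coords e -` box l u \<inter> space ?N = (?BA \<times> ?BC) \<times> ?BF"
    by (auto simp: mem_box_cart all_UNIV join_coords_def bij_Plus_inv[OF e] space_pair_measure)
  moreover have "join_coords e \<in> measurable ?N borel"
    using borel_measurable_join_coords by (simp add: measurable_cong_sets[OF sets refl])
  ultimately have "emeasure (distr ?N borel (join_coords e)) (box l u) = emeasure ?N ((?BA \<times> ?BC) \<times> ?BF)"
    by (simp add: emeasure_distr)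
  also have "\<dots> = emeasure (lborel_on A) ?BA * emeasure (lborel_on C) ?BC * emeasure (lborel_on F) ?BF"
    by (subst F.emeasure_pair_measure_Times, simp_all add: pair_measureI)
      (subst C.emeasure_pair_measure_Times, simp_all)
  also have "\<dots> = (\<Prod>i\<in>UNIV. ennreal (u $ i - l $ i))"
    using lu by (simp add: emeasure_lborel_on_box prod.Plus_betw[OF e])
  finally show "emeasure (distr ?N borel (join_coords e)) (box l u) = (\<Prod>i\<in>UNIV. ennreal (u $ i - l $ i))" .
qed simp

text \<open>Measurability is asked only of the composite with \<open>split_coords\<close>, because
  the integrand may be arbitrary off the coordinate subspaces. Splitting after joining is the
  identity almost everywhere, which suffices for the integrals to agree.\<close>

lemma nn_integral_split_coords:
  fixes A :: "'j::finite set" and C F :: "'p::finite set" and e :: "'n::finite \<Rightarrow> 'j + 'p + 'p"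
  assumes e: "bij_betw e UNIV (A <+> (C <+> F))"
    and g: "(\<lambda>v. g (split_coords e A C F v)) \<in> borel_measurable borel"
  shows "(\<integral>\<^sup>+x. g x \<partial>((lborel_on A \<Otimes>\<^sub>M lborel_on C) \<Otimes>\<^sub>M lborel_on F))
    = (\<integral>\<^sup>+v. g (split_coords e A C F v) \<partial>lborel)"
proof -
  let ?N = "(lborel_on A \<Otimes>\<^sub>M lborel_on C) \<Otimes>\<^sub>M lborel_on F"
  interpret AC: pair_sigma_finite "lborel_on A" "lborel_on C"
    by (intro pair_sigma_finite.intro sigma_finite_lborel_on)
  interpret ACF: pair_sigma_finite "lborel_on A \<Otimes>\<^sub>M lborel_on C" "lborel_on F"
    by (intro pair_sigma_finite.intro sigma_finite_lborel_on AC.sigma_finite_measure_axioms)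
  have sets: "sets ?N = sets borel"
    by (simp add: borel_prod[symmetric] cong: sets_pair_measure_cong)
  have m: "join_coords e \<in> measurable ?N borel"
    using borel_measurable_join_coords by (simp add: measurable_cong_sets[OF sets refl])
  have "AE x in lborel_on A. AE y in lborel_on C. fst (x, y) \<in> coord_space A \<and> snd (x, y) \<in> coord_space C"
    using AE_lborel_on[of A]
    by eventually_elim (use AE_lborel_on[of C] in \<open>eventually_elim, simp\<close>)
  then have "AE x in lborel_on A \<Otimes>\<^sub>M lborel_on C. fst x \<in> coord_space A \<and> snd x \<in> coord_space C"
    by (rule AC.AE_pair_measure[rotated]) measurable
  then have "AE x in lborel_on A \<Otimes>\<^sub>M lborel_on C. AE y in lborel_on F.
      (fst (fst (x, y)) \<in> coord_space A \<and> snd (fst (x, y)) \<in> coord_space C) \<and> snd (x, y) \<in> coord_space F"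
    by eventually_elim (use AE_lborel_on[of F] in \<open>eventually_elim, simp\<close>)
  then have "AE x in ?N. (fst (fst x) \<in> coord_space A \<and> snd (fst x) \<in> coord_space C) \<and> snd x \<in> coord_space F"
    by (rule ACF.AE_pair_measure[rotated]) measurable
  then have "AE x in ?N. g x = g (split_coords e A C F (join_coords e x))"
    by eventually_elim (auto simp: split_join_coords[OF e])
  then have "(\<integral>\<^sup>+x. g x \<partial>?N) = (\<integral>\<^sup>+x. g (split_coords e A C F (join_coords e x)) \<partial>?N)"
    by (rule nn_integral_cong_AE)
  also have "\<dots> = (\<integral>\<^sup>+v. g (split_coords e A C F v) \<partial>distr ?N borel (join_coords e))"
    using g by (subst nn_integral_distr[OF m]) simp_all
  finally show ?thesis by (simp add: distr_join_coords[OF e])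
qed

section \<open>Pseudo-inverse and row space\<close>

lemma matrix_gram_kernel:
  fixes M :: "real ^ 'b ^ 'a"
  assumes "(transpose M ** M) *v x = 0"
  shows "M *v x = 0"
proof -
  have "(M *v x) \<bullet> (M *v x) = x \<bullet> ((transpose M ** M) *v x)"
    by (simp add: dot_lmul_matrix[symmetric] matrix_vector_mul_assoc[symmetric] transpose_matrix_vector inner_commute)
  then show ?thesis using assms by simp
qed

text \<open>For injective \<open>M\<close> the Gram matrix has an inverse \<open>Gi\<close>, and
  \<open>Gi ** transpose M\<close> solves the Penrose equations. As \<open>pinv\<close> is a
  definite description, uniqueness of the solution is needed as well.\<close>

lemma pinv_mult_injective:
  fixes M :: "real ^ 'b ^ 'a"
  assumes inj: "\<And>x. M *v x = 0 \<Longrightarrow> x = 0"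
  shows "pinv M ** M = mat 1"
proof -
  define G where "G = transpose M ** M"
  have "\<exists>B. B ** G = mat 1"
    unfolding matrix_left_invertible_ker G_def using matrix_gram_kernel inj by blast
  then obtain Gi where Gi: "Gi ** G = mat 1" by blast
  then have Gi': "G ** Gi = mat 1" using matrix_left_right_inverse by blast
  have Gt: "transpose G = G" by (simp add: G_def matrix_transpose_mul transpose_transpose)
  have "transpose Gi ** G = mat 1"
    using arg_cong[OF Gi', of transpose] by (simp add: matrix_transpose_mul Gt transpose_mat)
  then have "transpose Gi ** G ** Gi = mat 1 ** Gi" by simp
  then have Git: "transpose Gi = Gi"
    by (simp only: matrix_mul_assoc[symmetric] Gi' matrix_mul_lid matrix_mul_rid)
  define N where "N = Gi ** transpose M"
  have NM: "N ** M = mat 1" using Gi by (simp add: N_def G_def matrix_mul_assoc[symmetric])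
  let ?P = "\<lambda>N. M ** N ** M = M \<and> N ** M ** N = N \<and>
                    transpose (M ** N) = M ** N \<and> transpose (N ** M) = N ** M"
  have "?P N"
    using NM Git by (simp add: matrix_mul_assoc[symmetric] matrix_transpose_mul N_def transpose_transpose transpose_mat)
  then have symN: "transpose (M ** N) = M ** N" "(M ** N) ** M = M" by simp_all
  have left: "L ** M = mat 1" if "?P L" for L
  proof -
    have "N ** M ** (L ** M) = N ** (M ** L ** M)" by (simp only: matrix_mul_assoc)
    also have "\<dots> = N ** M" using that by simp
    finally show ?thesis by (simp only: NM matrix_mul_lid)
  qed
  \<comment> \<open>\<open>M ** L\<close> and \<open>M ** N\<close> are symmetric and both fix
    \<open>M\<close>, so each is the orthogonal projection onto the range of \<open>M\<close>.
    Cancelling \<open>M\<close> on the left gives the claim.\<close>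
  have unique: "L = N" if L: "?P L" for L
  proof -
    have symL: "transpose (M ** L) = M ** L" "(M ** L) ** M = M" using L by simp_all
    have "M ** L = (M ** N) ** M ** L" by (simp only: symN)
    also have "\<dots> = (M ** N) ** (M ** L)" by (simp only: matrix_mul_assoc)
    also have "\<dots> = transpose (M ** N) ** transpose (M ** L)" by (simp only: symN symL)
    also have "\<dots> = transpose ((M ** L) ** (M ** N))" by (simp only: matrix_transpose_mul)
    also have "(M ** L) ** (M ** N) = (M ** L) ** M ** N" by (simp only: matrix_mul_assoc)
    also have "transpose \<dots> = M ** N" by (simp only: symL symN)
    finally have "N ** M ** L = N ** M ** N" by (simp only: matrix_mul_assoc[symmetric])
    then show ?thesis by (simp only: NM matrix_mul_lid)
  qed
  from \<open>?P N\<close> unique have "?P (pinv M)"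
    unfolding pinv_def by (rule theI[of ?P N])
  with left show ?thesis by blast
qed

lemma vector_matrix_mult_nth: "((y :: real ^ 'n) v* X) $ k = column k X \<bullet> y"
  by (simp add: vector_matrix_mult_def column_def inner_vec_def mult.commute)

text \<open>Any n columns are independent and hence span the space; a vector orthogonal to all of
  them is orthogonal to itself.\<close>

lemma general_position_transpose_inj:
  fixes X :: "real ^ 'p ^ 'n"
  assumes "CARD('n) \<le> CARD('p)"
    and gp: "\<And>B. card B = CARD('n) \<Longrightarrow> columns_independent X B"
    and y: "transpose X *v y = 0"
  shows "y = 0"
proof -
  obtain B :: "'p set" where B: "card B = CARD('n)"
    using assms(1) by (meson obtain_subset_with_card_n)
  let ?C = "(\<lambda>k. column k X) ` B"
  have ind: "independent ?C" and "card ?C = CARD('n)"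
    using gp[OF B] B by (auto simp: columns_independent_def card_image)
  then have "dim ?C = DIM(real ^ 'n)"
    by (simp add: dim_eq_card_independent)
  then have "span ?C = UNIV"
    by (simp only: dim_eq_full)
  moreover have "y \<bullet> x = 0" if "x \<in> span ?C" for x
    using that
  proof (rule span_induct_alt, simp)
    fix c x z assume "x \<in> ?C" "y \<bullet> z = 0"
    then show "y \<bullet> (c *\<^sub>R x + z) = 0"
      using y by (auto simp: inner_add_right vec_eq_iff vector_matrix_mult_nth inner_commute)
  qed
  ultimately have "y \<bullet> y = 0" by blast
  then show ?thesis by simp
qed

lemma weight_mat_mult: "weight_mat G w *v s = (\<chi> k. w (grp G k) * s $ k)"
  by (simp add: weight_mat_def matrix_vector_mult_def vec_eq_iff if_distrib[where f="\<lambda>x. x * _"] cong: if_cong)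

lemma weight_mat_inv:
  assumes "\<And>j. w j \<noteq> 0"
  shows "matrix_inv (weight_mat G w) = weight_mat G (\<lambda>j. inverse (w j))"
proof -
  have 1: "weight_mat G w ** weight_mat G v = mat 1" if "\<And>j. w j * v j = 1" for w v
  proof -
    have "weight_mat G w *v (weight_mat G v *v x) = mat 1 *v x" for x
      by (simp add: weight_mat_mult vec_eq_iff that mult.assoc[symmetric])
    then show ?thesis by (simp add: matrix_eq matrix_vector_mul_assoc)
  qed
  let ?W = "weight_mat G w" and ?V = "weight_mat G (\<lambda>j. inverse (w j))"
  have "?W ** ?V = mat 1" "?V ** ?W = mat 1"
    using assms by (auto intro!: 1)
  note WV = this
  show ?thesis
    unfolding matrix_inv_def
  proof (rule some_equality)
    fix N assume "?W ** N = mat 1 \<and> N ** ?W = mat 1"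
    then have "?V ** (?W ** N) = ?V" by simp
    then show "N = ?V" by (simp add: matrix_mul_assoc WV)
  qed (use WV in simp)
qed

text \<open>The weights cancel on each generating row, leaving a column of
  \<open>transpose X\<close>, and the property is preserved by linear combinations. This is what
  makes the subgradient equation solvable for the response.\<close>

lemma row_space_V_range:
  fixes X :: "real ^ 'p ^ 'n" and G :: "'j::finite \<Rightarrow> 'p set"
  assumes w: "\<And>j. w j > 0" and s: "s \<in> row_space_V X G w"
  shows "weight_mat G w *v s \<in> range ((*v) (transpose X))"
proof -
  let ?T = "{s. weight_mat G w *v s \<in> range ((*v) (transpose X))}"
  have "row_space_V X G w \<subseteq> ?T"
    unfolding row_space_V_def
  proof (rule span_minimal)
    have lin: "subspace (range ((*v) (transpose X)))"
      by (rule linear_subspace_image) auto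
    have "?T = (*v) (weight_mat G w) -` range ((*v) (transpose X))" by auto
    then show "subspace ?T"
      using linear_subspace_vimage[OF matrix_vector_mul_linear lin] by simp
    show "rows (X ** matrix_inv (weight_mat G w)) \<subseteq> ?T"
    proof
      fix s assume "s \<in> rows (X ** matrix_inv (weight_mat G w))"
      then obtain i where s: "s = row i (X ** matrix_inv (weight_mat G w))" by (auto simp: rows_def)
      have "w j \<noteq> 0" for j using w[of j] by simp
      then have "weight_mat G w *v s = transpose X *v axis i 1"
        unfolding s weight_mat_inv[OF \<open>\<And>j. w j \<noteq> 0\<close>]
        using \<open>\<And>j. w j \<noteq> 0\<close> by (simp add: weight_mat_mult vec_eq_iff vector_matrix_mult_nth inner_axis column_def row_def
            matrix_matrix_mult_def) (simp add: weight_mat_def if_distrib[where f="\<lambda>x. _ * x"] cong: if_cong)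
      then show "s \<in> ?T" by blast
    qed
  qed
  with s show ?thesis by blast
qed

section \<open>Optimality conditions\<close>

lemma abs_le_infnorm_restr: "k \<in> B \<Longrightarrow> \<bar>b $ k\<bar> \<le> infnorm (restr B b)"
  using component_le_infnorm_cart[of "restr B b" k] by (simp add: restr_def)

lemma infnorm_restr_le:
  assumes "\<And>k. k \<in> B \<Longrightarrow> \<bar>b $ k\<bar> \<le> c" "c \<ge> 0"
  shows "infnorm (restr B b) \<le> c"
proof -
  have "infnorm (restr B b) = Sup (range (\<lambda>i. \<bar>restr B b $ i\<bar>))"
    by (simp add: infnorm_cart full_SetCompr_eq)
  also have "\<dots> \<le> c"
    using assms by (intro cSUP_least) (auto simp: restr_def)
  finally show ?thesis .
qed

lemma restr_add: "restr B (x + y) = restr B x + restr B y"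
  and restr_scaleR: "restr B (c *\<^sub>R x) = c *\<^sub>R restr B x"
  by (simp_all add: restr_def vec_eq_iff)

definition penalty :: "('j::finite \<Rightarrow> 'p::finite set) \<Rightarrow> ('j \<Rightarrow> real) \<Rightarrow> real ^ 'p \<Rightarrow> real" where
  "penalty G w b = (\<Sum>j\<in>UNIV. w j * infnorm (restr (G j) b))"

lemma penalty_scaleR: "penalty G w (c *\<^sub>R b) = \<bar>c\<bar> * penalty G w b"
  by (simp add: penalty_def restr_scaleR infnorm_mul sum_distrib_left mult.left_commute)

lemma penalty_triangle: "(\<And>j. w j \<ge> 0) \<Longrightarrow> penalty G w (x + y) \<le> penalty G w x + penalty G w y"
  unfolding penalty_def restr_add sum.distrib[symmetric] distrib_left[symmetric]
  by (intro sum_mono mult_left_mono infnorm_triangle) auto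

text \<open>The point is a convex combination of \<open>x\<close> and \<open>x + d\<close>, and the
  penalty is a seminorm.\<close>

lemma penalty_convex:
  assumes "\<And>j. w j \<ge> 0" "0 \<le> t" "t \<le> 1"
  shows "penalty G w (x + t *\<^sub>R d) \<le> penalty G w x + t * (penalty G w (x + d) - penalty G w x)"
proof -
  have "x + t *\<^sub>R d = (1 - t) *\<^sub>R x + t *\<^sub>R (x + d)"
    by (simp add: algebra_simps)
  also have "penalty G w \<dots> \<le> (1 - t) * penalty G w x + t * penalty G w (x + d)"
    using penalty_triangle[of w G "(1 - t) *\<^sub>R x" "t *\<^sub>R (x + d)"] assms
    by (simp add: penalty_scaleR)
  finally show ?thesis by (simp add: algebra_simps)
qed

text \<open>Expanding the square leaves a term linear in the residual, which the subgradient
  equation turns into the pairing with the weighted \<open>s\<close>. Sufficiency and necessity of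
  the optimality conditions both start from this identity.\<close>

lemma block_lasso_objective_diff:
  fixes X :: "real ^ 'p ^ 'n"
  assumes "subgradient_eq X G w lam y b s"
  shows "block_lasso_objective X G w lam y (b + d) - block_lasso_objective X G w lam y b
    = (norm (X *v d))\<^sup>2 / (2 * real CARD('n)) + lam * (penalty G w (b + d) - penalty G w b)
      - lam * ((weight_mat G w *v s) \<bullet> d)"
proof -
  let ?n = "real CARD('n)"
  let ?e = "y - X *v b"
  have "lam *\<^sub>R (weight_mat G w *v s) = (1 / ?n) *\<^sub>R (transpose X *v ?e)"
    using assms by (simp add: subgradient_eq_def Psi_def scaleR_matrix_vector_assoc[symmetric]
        matrix_vector_mul_assoc[symmetric] algebra_simps matrix_vector_mult_diff_distrib
        vector_matrix_mult_diff_distrib)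
  then have "lam * ((weight_mat G w *v s) \<bullet> d) = (1 / ?n) * ((transpose X *v ?e) \<bullet> d)"
    by (metis inner_scaleR_left)
  also have "(transpose X *v ?e) \<bullet> d = ?e \<bullet> (X *v d)"
    by (simp add: dot_lmul_matrix)
  finally have 1: "lam * ((weight_mat G w *v s) \<bullet> d) = (?e \<bullet> (X *v d)) / ?n"
    by simp
  have "(norm (y - X *v (b + d)))\<^sup>2 = (norm (?e - X *v d))\<^sup>2"
    by (simp add: matrix_vector_right_distrib algebra_simps)
  also have "\<dots> = (norm ?e)\<^sup>2 - 2 * (?e \<bullet> (X *v d)) + (norm (X *v d))\<^sup>2"
    unfolding power2_norm_eq_inner by (simp add: inner_diff inner_commute algebra_simps)
  finally have "(norm (y - X *v (b + d)))\<^sup>2 = (norm ?e)\<^sup>2 - 2 * (?e \<bullet> (X *v d)) + (norm (X *v d))\<^sup>2" .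
  then show ?thesis
    unfolding 1 by (simp add: block_lasso_objective_def penalty_def[symmetric] add_divide_distrib
        diff_divide_distrib right_diff_distrib)
qed

text \<open>The subdifferential of a seminorm at \<open>b\<close> consists of the linear functionals
  that it dominates and that attain its value at \<open>b\<close>. This form is independent of the
  group structure.\<close>

definition kkt ::
  "real ^ 'p ^ 'n \<Rightarrow> ('j::finite \<Rightarrow> 'p set) \<Rightarrow> ('j \<Rightarrow> real) \<Rightarrow> real \<Rightarrow> real ^ 'n
     \<Rightarrow> real ^ 'p \<Rightarrow> real ^ 'p \<Rightarrow> bool" where
  "kkt X G w lam y b s \<longleftrightarrow> subgradient_eq X G w lam y b s \<and>
     (\<forall>v. (weight_mat G w *v s) \<bullet> v \<le> penalty G w v) \<and>
     (weight_mat G w *v s) \<bullet> b = penalty G w b"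

text \<open>In the expansion of the objective the quadratic term is nonnegative and the penalty
  difference dominates the pairing.\<close>

lemma kkt_imp_solution:
  fixes X :: "real ^ 'p ^ 'n"
  assumes "kkt X G w lam y b s" "lam > 0"
  shows "block_lasso_solution X G w lam y b"
proof -
  have "block_lasso_objective X G w lam y b \<le> block_lasso_objective X G w lam y b'" for b'
  proof -
    have "lam * ((weight_mat G w *v s) \<bullet> (b' - b)) \<le> lam * (penalty G w b' - penalty G w b)"
      using assms by (intro mult_left_mono) (auto simp: kkt_def inner_diff_right)
    moreover have "0 \<le> (norm (X *v (b' - b)))\<^sup>2 / (2 * real CARD('n))" by simp
    moreover have "block_lasso_objective X G w lam y b' - block_lasso_objective X G w lam y b
      = (norm (X *v (b' - b)))\<^sup>2 / (2 * real CARD('n)) + lam * (penalty G w b' - penalty G w b)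
      - lam * ((weight_mat G w *v s) \<bullet> (b' - b))"
      using block_lasso_objective_diff[of X G w lam y b s "b' - b"] assms by (simp add: kkt_def)
    ultimately show ?thesis by linarith
  qed
  then show ?thesis
    by (simp add: block_lasso_solution_def is_arg_min_linorder)
qed

lemma nonneg_if_quadratic_nonneg:
  fixes c q :: real
  assumes "\<And>t. 0 < t \<Longrightarrow> t \<le> 1 \<Longrightarrow> 0 \<le> t\<^sup>2 * q + t * c"
  shows "0 \<le> c"
proof (rule tendsto_lowerbound)
  show "((\<lambda>t. t * q + c) \<longlongrightarrow> c) (at_right 0)"
    by (auto intro!: tendsto_eq_intros)
  show "\<forall>\<^sub>F t in at_right 0. 0 \<le> t * q + c"
  proof (rule eventually_at_rightI[of 0 1])
    fix t :: real assume "t \<in> {0<..<1}"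
    then have "0 \<le> t * (t * q + c)" "t > 0"
      using assms[of t] by (auto simp: algebra_simps power2_eq_square)
    then show "0 \<le> t * q + c" by (simp add: zero_le_mult_iff)
  qed simp
qed simp

text \<open>Moving from \<open>b\<close> by \<open>t\<close> times \<open>d\<close>, convexity
  bounds the penalty change linearly in \<open>t\<close>, so minimality makes the first-order
  coefficient nonnegative as \<open>t\<close> tends to zero.\<close>

lemma solution_imp_kkt:
  fixes X :: "real ^ 'p ^ 'n"
  assumes sol: "block_lasso_solution X G w lam y b" and sub: "subgradient_eq X G w lam y b s"
    and lam: "lam > 0" and w: "\<And>j. w j > 0"
  shows "kkt X G w lam y b s"
proof -
  let ?Ws = "weight_mat G w *v s" and ?n = "real CARD('n)"
  have w0: "\<And>j. w j \<ge> 0" using w by (simp add: less_imp_le)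
  have key: "?Ws \<bullet> d \<le> penalty G w (b + d) - penalty G w b" for d
  proof -
    let ?q = "(norm (X *v d))\<^sup>2 / (2 * ?n)"
    let ?c = "lam * (penalty G w (b + d) - penalty G w b) - lam * (?Ws \<bullet> d)"
    have "0 \<le> t\<^sup>2 * ?q + t * ?c" if t: "0 < t" "t \<le> 1" for t
    proof -
      have "0 \<le> block_lasso_objective X G w lam y (b + t *\<^sub>R d) - block_lasso_objective X G w lam y b"
        using sol by (simp add: block_lasso_solution_def is_arg_min_linorder)
      also have "\<dots> = t\<^sup>2 * ?q + lam * (penalty G w (b + t *\<^sub>R d) - penalty G w b) - t * (lam * (?Ws \<bullet> d))"
        unfolding block_lasso_objective_diff[OF sub]
        by (simp add: matrix_vector_mult_scaleR power_mult_distrib)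
      also have "\<dots> \<le> t\<^sup>2 * ?q + lam * (t * (penalty G w (b + d) - penalty G w b)) - t * (lam * (?Ws \<bullet> d))"
        using penalty_convex[where t=t and x=b and d=d and G=G and w=w] w0 t lam by (simp add: mult_left_mono)
      finally show ?thesis by (simp add: algebra_simps)
    qed
    then have "0 \<le> ?c" by (rule nonneg_if_quadratic_nonneg)
    then have "0 \<le> lam * (penalty G w (b + d) - penalty G w b - ?Ws \<bullet> d)" by (simp add: algebra_simps)
    then show ?thesis using lam by (simp add: zero_le_mult_iff)
  qed
  have p0: "penalty G w 0 = 0" using penalty_scaleR[of G w 0 0] by simp
  have p2: "penalty G w (b + b) = 2 * penalty G w b"
    using penalty_scaleR[of G w 2 b] by (simp add: scaleR_2)
  \<comment> \<open>By homogeneity the directions \<open>b\<close> and \<open>- b\<close> give the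
    two opposite inequalities.\<close>
  have eq: "?Ws \<bullet> b = penalty G w b"
    using key[of b] key[of "- b"] p0 p2 by simp
  have "?Ws \<bullet> v \<le> penalty G w v" for v
    using key[of "v - b"] eq by (simp add: inner_diff_right)
  with eq sub show ?thesis by (simp add: kkt_def)
qed

text \<open>Subtracting the two equations, monotonicity makes the squared norm of
  \<open>X *v (b - b')\<close> nonpositive. So the fits agree, and with them the subgradients, even
  if \<open>b\<close> and \<open>b'\<close> differ.\<close>

lemma kkt_subgradient_unique:
  fixes X :: "real ^ 'p ^ 'n"
  assumes "kkt X G w lam y b s" "kkt X G w lam y b' s'" and lam: "lam > 0" and w: "\<And>j. w j > 0"
  shows "s = s'"
proof -
  let ?W = "weight_mat G w" and ?n = "real CARD('n)"
  have Psi: "Psi X *v (b - b') = - (lam *\<^sub>R (?W *v s - ?W *v s'))"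
    using assms(1,2) by (simp add: kkt_def subgradient_eq_def matrix_vector_mult_diff_distrib algebra_simps)
  have "(?W *v s) \<bullet> b' + (?W *v s') \<bullet> b \<le> penalty G w b' + penalty G w b"
    using assms(1,2) by (intro add_mono) (simp_all add: kkt_def)
  then have "0 \<le> (?W *v s - ?W *v s') \<bullet> (b - b')"
    using assms(1,2) by (simp add: kkt_def inner_diff algebra_simps)
  then have "(Psi X *v (b - b')) \<bullet> (b - b') \<le> 0"
    using lam by (simp add: Psi)
  also have "(Psi X *v (b - b')) \<bullet> (b - b') = (norm (X *v (b - b')))\<^sup>2 / ?n"
    by (simp add: Psi_def scaleR_matrix_vector_assoc[symmetric] matrix_vector_mul_assoc[symmetric]
        dot_lmul_matrix power2_norm_eq_inner)
  finally have "X *v (b - b') = 0" by (simp add: divide_le_0_iff)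
  then have "Psi X *v (b - b') = 0"
    by (simp add: Psi_def scaleR_matrix_vector_assoc[symmetric] matrix_vector_mul_assoc[symmetric])
  then have "?W *v s = ?W *v s'" using lam by (simp add: Psi)
  then have "w (grp G k) * s $ k = w (grp G k) * s' $ k" for k
    by (simp add: weight_mat_mult vec_eq_iff)
  moreover have "w (grp G k) \<noteq> 0" for k using w[of "grp G k"] by simp
  ultimately show ?thesis by (simp add: vec_eq_iff)
qed

lemma restr_nth: "restr B v $ k = (if k \<in> B then v $ k else 0)"
  by (simp add: restr_def)

lemma group_norms_nth: "group_norms G b $ j = infnorm (restr (G j) b)"
  by (simp add: group_norms_def)

section \<open>Optimality conditions group by group\<close>

locale weighted_groups =
  fixes G :: "'j::finite \<Rightarrow> 'p::finite set" and w :: "'j \<Rightarrow> real"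
  assumes disj: "disjoint_family G" and cover: "(\<Union>j. G j) = UNIV" and w_pos: "w j > 0"
begin

lemma grp_eq: "k \<in> G j \<Longrightarrow> grp G k = j"
  unfolding grp_def using disj by (intro the_equality) (auto simp: disjoint_family_on_def)

lemma in_grp: "k \<in> G (grp G k)"
proof -
  obtain j where "k \<in> G j" using cover by blast
  then show ?thesis using grp_eq by simp
qed

lemma in_group_iff: "k \<in> G j \<longleftrightarrow> grp G k = j"
  using grp_eq in_grp by blast

lemma in_group_union_iff: "k \<in> group_union G A \<longleftrightarrow> grp G k \<in> A"
  by (auto simp: group_union_def in_group_iff)

lemma weighted_inner:
  "(weight_mat G w *v s) \<bullet> v = (\<Sum>j\<in>UNIV. w j * (\<Sum>k\<in>G j. s $ k * v $ k))"
proof -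
  have "(weight_mat G w *v s) \<bullet> v = (\<Sum>k\<in>(\<Union>j. G j). w (grp G k) * (s $ k * v $ k))"
    unfolding cover by (simp add: weight_mat_mult inner_vec_def mult.assoc)
  also have "\<dots> = (\<Sum>j\<in>UNIV. \<Sum>k\<in>G j. w (grp G k) * (s $ k * v $ k))"
    using disj by (intro sum.UNION_disjoint) (auto simp: disjoint_family_on_def)
  also have "\<dots> = (\<Sum>j\<in>UNIV. w j * (\<Sum>k\<in>G j. s $ k * v $ k))"
    by (intro sum.cong refl) (simp add: sum_distrib_left grp_eq)
  finally show ?thesis .
qed

text \<open>Hoelder's inequality for the dual pair of the one-norm and the maximum norm.\<close>

lemma pairing_le:
  assumes "l1_on B s \<le> 1"
  shows "(\<Sum>k\<in>B. s $ k * v $ k) \<le> infnorm (restr B v)"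
proof -
  have "(\<Sum>k\<in>B. s $ k * v $ k) \<le> (\<Sum>k\<in>B. \<bar>s $ k\<bar> * infnorm (restr B v))"
  proof (rule sum_mono)
    fix k assume "k \<in> B"
    have "s $ k * v $ k \<le> \<bar>s $ k\<bar> * \<bar>v $ k\<bar>" by (metis abs_ge_self abs_mult)
    also have "\<dots> \<le> \<bar>s $ k\<bar> * infnorm (restr B v)"
      using \<open>k \<in> B\<close> by (intro mult_left_mono abs_le_infnorm_restr) auto
    finally show "s $ k * v $ k \<le> \<bar>s $ k\<bar> * infnorm (restr B v)" .
  qed
  also have "\<dots> = l1_on B s * infnorm (restr B v)"
    by (simp add: l1_on_def sum_distrib_right)
  also have "\<dots> \<le> infnorm (restr B v)"
    using mult_right_mono[OF assms infnorm_pos_le[of "restr B v"]] by simp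
  finally show ?thesis .
qed

text \<open>Pairing and penalty are sums over the groups with the same weights, so the conditions
  decouple. One direction is \<open>pairing_le\<close> in every group; the other tests with a sign
  vector supported on one group and uses that termwise inequalities with equal sums are
  equalities.\<close>

lemma kkt_iff:
  "kkt X G w lam y b s \<longleftrightarrow> subgradient_eq X G w lam y b s \<and>
     (\<forall>j. l1_on (G j) s \<le> 1 \<and> (\<Sum>k\<in>G j. s $ k * b $ k) = infnorm (restr (G j) b))"
proof (intro iffI conjI allI)
  assume *: "subgradient_eq X G w lam y b s \<and>
     (\<forall>j. l1_on (G j) s \<le> 1 \<and> (\<Sum>k\<in>G j. s $ k * b $ k) = infnorm (restr (G j) b))"
  have "(weight_mat G w *v s) \<bullet> v \<le> penalty G w v" for v
    unfolding weighted_inner penalty_def using * w_pos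
    by (intro sum_mono mult_left_mono pairing_le) (auto simp: less_imp_le)
  then show "kkt X G w lam y b s"
    using * by (simp add: kkt_def weighted_inner penalty_def)
next
  assume kkt: "kkt X G w lam y b s"
  then show "subgradient_eq X G w lam y b s" by (simp add: kkt_def)
  show l1: "l1_on (G j) s \<le> 1" for j
  proof -
    let ?v = "restr (G j) (sgn_vec s)"
    have "w j * l1_on (G j) s = (weight_mat G w *v s) \<bullet> ?v"
    proof -
      have pair: "(\<Sum>k\<in>G i. s $ k * ?v $ k) = (if i = j then l1_on (G j) s else 0)" for i
        by (auto simp: in_group_iff restr_def sgn_vec_def l1_on_def abs_sgn intro!: sum.cong sum.neutral)
      show ?thesis unfolding weighted_inner pair by (simp add: if_distrib cong: if_cong)
    qed
    also have "\<dots> \<le> penalty G w ?v" using kkt by (simp add: kkt_def)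
    also have "\<dots> \<le> (\<Sum>i\<in>UNIV. if i = j then w j else 0)"
      unfolding penalty_def
    proof (rule sum_mono)
      fix i
      have "restr (G i) ?v = (if i = j then ?v else 0)"
        using grp_eq by (auto simp: restr_def vec_eq_iff)
      moreover have "infnorm ?v \<le> 1"
        by (rule infnorm_restr_le) (auto simp: sgn_vec_def abs_sgn_eq)
      ultimately show "w i * infnorm (restr (G i) ?v) \<le> (if i = j then w j else 0)"
        using w_pos[of i] by (auto simp: infnorm_0)
    qed
    finally show ?thesis using w_pos[of j] by simp
  qed
  fix j
  have le: "w i * (\<Sum>k\<in>G i. s $ k * b $ k) \<le> w i * infnorm (restr (G i) b)" for i
    using w_pos[of i] pairing_le[OF l1] by simp
  have "(\<Sum>i\<in>UNIV. w i * (\<Sum>k\<in>G i. s $ k * b $ k)) = (\<Sum>i\<in>UNIV. w i * infnorm (restr (G i) b))"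
    using kkt by (simp add: kkt_def weighted_inner penalty_def)
  then have "w j * (\<Sum>k\<in>G j. s $ k * b $ k) = w j * infnorm (restr (G j) b)"
    by (rule sum_mono_inv[OF _ le]) auto
  then show "(\<Sum>k\<in>G j. s $ k * b $ k) = infnorm (restr (G j) b)"
    using w_pos[of j] by simp
qed

text \<open>Equality in Hoelder's inequality forces equality in every term, so wherever
  \<open>s\<close> is nonzero \<open>b\<close> has maximal modulus and the sign of
  \<open>s\<close>.\<close>

lemma kkt_extremal:
  assumes kkt: "kkt X G w lam y b s" and k: "k \<in> G j" "s $ k \<noteq> 0"
  shows "b $ k = infnorm (restr (G j) b) * sgn (s $ k)"
proof -
  let ?m = "infnorm (restr (G j) b)"
  have eq: "(\<Sum>k\<in>G j. s $ k * b $ k) = ?m" and l1: "l1_on (G j) s \<le> 1"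
    using kkt by (auto simp: kkt_iff)
  have le: "s $ i * b $ i \<le> \<bar>s $ i\<bar> * ?m" if "i \<in> G j" for i
  proof -
    have "s $ i * b $ i \<le> \<bar>s $ i\<bar> * \<bar>b $ i\<bar>" by (metis abs_ge_self abs_mult)
    then show ?thesis using mult_left_mono[OF abs_le_infnorm_restr[OF that, of b], of "\<bar>s $ i\<bar>"] by simp
  qed
  have sum_mono_le: "(\<Sum>i\<in>G j. s $ i * b $ i) \<le> (\<Sum>i\<in>G j. \<bar>s $ i\<bar> * ?m)"
    using le by (rule sum_mono)
  have "(\<Sum>i\<in>G j. \<bar>s $ i\<bar> * ?m) = l1_on (G j) s * ?m" by (simp add: l1_on_def sum_distrib_right)
  also have "\<dots> \<le> ?m" using mult_right_mono[OF l1 infnorm_pos_le[of "restr (G j) b"]] by simp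
  finally have "(\<Sum>i\<in>G j. s $ i * b $ i) = (\<Sum>i\<in>G j. \<bar>s $ i\<bar> * ?m)"
    using eq sum_mono_le by (intro antisym) auto
  then have "s $ k * b $ k = \<bar>s $ k\<bar> * ?m"
    by (rule sum_mono_inv[OF _ le]) (use k in auto)
  also have "\<dots> = s $ k * (?m * sgn (s $ k))"
    by (metis abs_sgn mult.assoc mult.commute)
  finally show ?thesis using k(2) by simp
qed

text \<open>The representation loses nothing: \<open>kkt_extremal\<close> restores the entries on
  \<open>K\<close>, those on \<open>Kc G A K\<close> are kept, and all others lie in inactive
  groups.\<close>

lemma full_beta_of_kkt:
  assumes kkt: "kkt X G w lam y b s" and A: "active_groups G b = A" and K: "active_K G b s = K"
  shows "full_beta G A K (restr A (group_norms G b)) (restr (Kc G A K) b) s = b"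
proof -
  have "full_beta G A K (restr A (group_norms G b)) (restr (Kc G A K) b) s $ k = b $ k" for k
  proof -
    consider "k \<in> K" | "k \<notin> K" "k \<in> Kc G A K" | "k \<notin> K" "k \<notin> Kc G A K" by blast
    then show ?thesis
    proof cases
      case 1
      then have "s $ k \<noteq> 0" "grp G k \<in> A"
        using A K by (auto simp: active_K_def in_group_iff)
      then show ?thesis
        using 1 kkt_extremal[OF kkt in_grp] by (simp add: full_beta_def restr_def group_norms_def)
    next
      case 2
      then show ?thesis by (simp add: full_beta_def restr_def)
    next
      case 3
      then have "grp G k \<notin> A" by (auto simp: Kc_def in_group_union_iff)
      then have "restr (G (grp G k)) b = 0" using A by (auto simp: active_groups_def)
      then have "restr (G (grp G k)) b $ k = 0" by simp
      then have "b $ k = 0"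
        using in_grp[of k] by (simp add: restr_def)
      with 3 show ?thesis by (simp add: full_beta_def)
    qed
  qed
  then show ?thesis by (simp add: vec_eq_iff)
qed

section \<open>Points of the sample space as solutions\<close>

context
  fixes X :: "real ^ 'p ^ 'n" and A :: "'j set" and K :: "'p set" and s :: "real ^ 'p"
    and r :: "real ^ 'j" and b :: "real ^ 'p"
  assumes K: "K \<subseteq> group_union G A" "\<And>j. j \<in> A \<Longrightarrow> K \<inter> G j \<noteq> {}"
    and s: "s \<in> M_interior X G w A K" and rb: "(r, b) \<in> cone_prod G A K"
begin

lemma M_interior_zero: "k \<in> Kc G A K \<Longrightarrow> s $ k = 0"
  using s in_grp[of k] by (auto simp: M_interior_def M_set_def Kc_def in_group_union_iff)

text \<open>Interior points have support exactly \<open>K\<close> within the active groups; this is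
  what allows \<open>K\<close> to be read off from \<open>s\<close>.\<close>

lemma M_interior_support: "grp G k \<in> A \<Longrightarrow> s $ k \<noteq> 0 \<longleftrightarrow> k \<in> K"
  using M_interior_zero[of k] s by (auto simp: Kc_def in_group_union_iff M_interior_def)

lemma M_interior_l1: "j \<in> A \<Longrightarrow> l1_on (G j) s = 1" "l1_on (G j) s \<le> 1"
proof -
  show 1: "l1_on (G j) s = 1" if "j \<in> A" for j
  proof -
    have "l1_on (G j) s = l1_on (K \<inter> G j) s"
      unfolding l1_on_def
      using that by (intro sum.mono_neutral_right) (auto simp: in_group_iff M_interior_support[symmetric])
    also have "\<dots> = 1" using s that by (auto simp: M_interior_def M_set_def)
    finally show ?thesis .
  qed
  show "l1_on (G j) s \<le> 1"
    using s 1[of j] by (cases "j \<in> A") (auto simp: M_interior_def M_set_def)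
qed

lemma full_beta_nth_out: "grp G k \<notin> A \<Longrightarrow> full_beta G A K r b s $ k = 0"
  using K(1) by (auto simp: full_beta_def Kc_def in_group_union_iff)

text \<open>The cone condition bounds the entries on \<open>Kc G A K\<close> by
  \<open>r $ j\<close>. The bound is attained because \<open>K\<close> meets the group and
  \<open>s\<close> is nonzero there.\<close>

lemma full_beta_norm: "infnorm (restr (G j) (full_beta G A K r b s)) = (if j \<in> A then r $ j else 0)"
proof (cases "j \<in> A")
  case True
  have rpos: "r $ j > 0" and ble: "infnorm (restr (Kc G A K \<inter> G j) b) \<le> r $ j"
    using rb True by (auto simp: cone_prod_def)
  have "\<bar>full_beta G A K r b s $ k\<bar> \<le> r $ j" if "k \<in> G j" for k
  proof (cases "k \<in> K")
    case True
    then show ?thesis using that rpos by (simp add: full_beta_def in_group_iff abs_mult abs_sgn_eq)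
  next
    case False
    then show ?thesis
      using that rpos abs_le_infnorm_restr[of k "Kc G A K \<inter> G j" b] ble by (auto simp: full_beta_def)
  qed
  then have "infnorm (restr (G j) (full_beta G A K r b s)) \<le> r $ j"
    using rpos by (intro infnorm_restr_le) auto
  moreover obtain k where k: "k \<in> K" "k \<in> G j" using K(2)[OF True] by blast
  have "r $ j \<le> infnorm (restr (G j) (full_beta G A K r b s))"
    using abs_le_infnorm_restr[OF k(2), of "full_beta G A K r b s"] k rpos M_interior_support[of k] True
    by (simp add: full_beta_def in_group_iff abs_mult abs_sgn_eq split: if_splits)
  ultimately show ?thesis using True by simp
next
  case False
  then have "restr (G j) (full_beta G A K r b s) = 0"
    by (auto simp: restr_def vec_eq_iff in_group_iff full_beta_nth_out)
  then show ?thesis using False by (simp add: infnorm_0)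
qed

text \<open>In an active group each product is \<open>r $ j\<close> times the modulus of
  \<open>s $ k\<close>, and these moduli sum to one.\<close>

lemma full_beta_pairing:
  "(\<Sum>k\<in>G j. s $ k * full_beta G A K r b s $ k) = infnorm (restr (G j) (full_beta G A K r b s))"
proof (cases "j \<in> A")
  case True
  have "(\<Sum>k\<in>G j. s $ k * full_beta G A K r b s $ k) = (\<Sum>k\<in>G j. r $ j * \<bar>s $ k\<bar>)"
  proof (rule sum.cong[OF refl])
    fix k assume "k \<in> G j"
    then show "s $ k * full_beta G A K r b s $ k = r $ j * \<bar>s $ k\<bar>"
      using True M_interior_support[of k] by (cases "k \<in> K") (auto simp: full_beta_def in_group_iff abs_sgn)
  qed
  also have "\<dots> = r $ j" using M_interior_l1(1)[OF True] by (simp add: l1_on_def flip: sum_distrib_left)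
  finally show ?thesis using True by (simp add: full_beta_norm)
next
  case False
  then show ?thesis unfolding full_beta_norm
    by (auto simp: in_group_iff full_beta_nth_out intro!: sum.neutral)
qed

lemma full_beta_kkt:
  "subgradient_eq X G w lam y (full_beta G A K r b s) s \<Longrightarrow> kkt X G w lam y (full_beta G A K r b s) s"
  by (simp add: kkt_iff M_interior_l1 full_beta_pairing)

text \<open>Positive radii make exactly the groups of \<open>A\<close> active. Together with
  \<open>full_beta_of_kkt\<close> this makes the passage between \<open>b\<close> and its
  coordinates invertible.\<close>

lemma full_beta_representation:
  "active_groups G (full_beta G A K r b s) = A"
  "active_K G (full_beta G A K r b s) s = K"
  "restr A (group_norms G (full_beta G A K r b s)) = r"
  "restr (Kc G A K) (full_beta G A K r b s) = b"
proof -
  have r: "j \<in> A \<Longrightarrow> r $ j > 0" "j \<notin> A \<Longrightarrow> r $ j = 0" for j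
    using rb by (auto simp: cone_prod_def coord_space_def)
  show act: "active_groups G (full_beta G A K r b s) = A"
    unfolding active_groups_def infnorm_pos_lt[symmetric] by (auto simp: full_beta_norm r)
  show "active_K G (full_beta G A K r b s) s = K"
    unfolding active_K_def act using M_interior_support K(1) by (fastforce simp: in_group_iff in_group_union_iff)
  show "restr A (group_norms G (full_beta G A K r b s)) = r"
    by (auto simp: vec_eq_iff restr_nth group_norms_nth full_beta_norm r)
  show "restr (Kc G A K) (full_beta G A K r b s) = b"
    using rb by (auto simp: vec_eq_iff restr_def full_beta_def cone_prod_def coord_space_def Kc_def)
qed

end

text \<open>By the subgradient equation the bracket in \<open>H_map\<close> is
  \<open>transpose X\<close> applied to \<open>z - X *v beta0\<close>, divided by n; the left
  inverse strips off \<open>transpose X\<close>.\<close>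

lemma H_map_eq:
  fixes X :: "real ^ 'p ^ 'n"
  assumes inj: "\<And>v. transpose X *v v = 0 \<Longrightarrow> v = 0"
    and sub: "subgradient_eq X G w lam z (full_beta G A K r b s) s"
  shows "H_map X G w lam beta0 A K r b s = (1 / sqrt (real CARD('n))) *\<^sub>R (z - X *v beta0)"
proof -
  let ?n = "real CARD('n)"
  have "Psi X *v full_beta G A K r b s + lam *\<^sub>R (weight_mat G w *v s) - Psi X *v beta0
      = (1 / ?n) *\<^sub>R (transpose X *v (z - X *v beta0))"
    using sub by (simp add: subgradient_eq_def Psi_def scaleR_matrix_vector_assoc[symmetric]
        matrix_vector_mul_assoc[symmetric] vector_matrix_mult_diff_distrib scaleR_diff_right)
  then have "H_map X G w lam beta0 A K r b s
      = (sqrt ?n * (1 / ?n)) *\<^sub>R ((pinv (transpose X) ** transpose X) *v (z - X *v beta0))"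
    by (simp add: H_map_def matrix_vector_mult_scaleR matrix_vector_mul_assoc[symmetric])
  also have "pinv (transpose X) ** transpose X = mat 1"
    using inj by (rule pinv_mult_injective)
  also have "sqrt ?n * (1 / ?n) = 1 / sqrt ?n"
    by (simp add: real_div_sqrt field_simps)
  finally show ?thesis by simp
qed

text \<open>Converse of \<open>H_map_eq\<close>: membership in the row space guarantees that some
  response satisfies the equation, and \<open>H_map_eq\<close> identifies that response.\<close>

lemma subgradient_eq_H_map:
  fixes X :: "real ^ 'p ^ 'n"
  assumes inj: "\<And>v. transpose X *v v = 0 \<Longrightarrow> v = 0"
    and s: "s \<in> row_space_V X G w"
  shows "subgradient_eq X G w lam (X *v beta0 + sqrt (real CARD('n)) *\<^sub>R H_map X G w lam beta0 A K r b s)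
    (full_beta G A K r b s) s"
proof -
  let ?n = "real CARD('n)" and ?b = "full_beta G A K r b s"
  obtain c where c: "weight_mat G w *v s = transpose X *v c"
    using row_space_V_range[OF w_pos s] by blast
  \<comment> \<open>The two summands produce the fit term and the weighted subgradient term of the
    equation after applying \<open>transpose X\<close> and dividing by n.\<close>
  define z where "z = X *v ?b + (?n * lam) *\<^sub>R c"
  have "(1 / ?n) *\<^sub>R (transpose X *v z) = Psi X *v ?b + lam *\<^sub>R (weight_mat G w *v s)"
    unfolding z_def c by (simp add: Psi_def scaleR_matrix_vector_assoc[symmetric]
        matrix_vector_mul_assoc[symmetric] vector_matrix_left_distrib scaleR_add_right
        scaleR_vector_matrix_assoc)
  then have sub: "subgradient_eq X G w lam z ?b s" by (simp add: subgradient_eq_def)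
  have "X *v beta0 + sqrt ?n *\<^sub>R H_map X G w lam beta0 A K r b s = z"
    using H_map_eq[OF inj sub, of beta0] by simp
  with sub show ?thesis by simp
qed

end

section \<open>Coordinates on the sample space\<close>

lemma matrix_vector_mult_restr:
  "T *v restr F d = (\<Sum>k\<in>F. d $ k *\<^sub>R column k (T :: real ^ 'b ^ 'a))"
proof -
  have "T *v restr F d = (\<Sum>k\<in>UNIV. restr F d $ k *\<^sub>R column k T)"
    by (simp add: matrix_mult_sum scalar_mult_eq_scaleR)
  also have "\<dots> = (\<Sum>k\<in>F. d $ k *\<^sub>R column k T)"
    by (intro sum.mono_neutral_cong_right) (auto simp: restr_nth)
  finally show ?thesis .
qed

lemma linear_restr: "linear (restr B)"
  by (rule linearI) (simp_all add: restr_add restr_scaleR)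

text \<open>One stratum with one parameterization. The bijection \<open>e\<close> also encodes that
  the block sizes add up to n.\<close>

locale chart = weighted_groups G w
  for G :: "'j::finite \<Rightarrow> 'p::finite set" and w :: "'j \<Rightarrow> real" +
  fixes X :: "real ^ 'p ^ 'n" and lam :: real and beta0 :: "real ^ 'p"
    and A :: "'j set" and K F :: "'p set" and \<Phi>0 :: "(real ^ 'p) set"
    and s :: "real ^ 'p \<Rightarrow> real ^ 'p" and T :: "real ^ 'p \<Rightarrow> real ^ 'p ^ 'p" and e :: "'n \<Rightarrow> 'j + 'p + 'p"
  assumes K: "K \<subseteq> group_union G A" "\<And>j. j \<in> A \<Longrightarrow> K \<inter> G j \<noteq> {}"
    and param: "parameterized X G w A K F \<Phi>0 s T"
    and e: "bij_betw e UNIV (A <+> (Kc G A K <+> F))"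
begin

text \<open>The components \<open>r\<^sub>A\<close>, \<open>b\<^sub>K\<^sub>c\<close> and \<open>s\<^sub>F\<close> of a coordinate vector \<open>\<theta>\<close>.\<close>

definition "rc v = fst (fst (split_coords e A (Kc G A K) F v))"
definition "bc v = snd (fst (split_coords e A (Kc G A K) F v))"
definition "uc v = snd (split_coords e A (Kc G A K) F v)"
text \<open>Only \<open>uc\<close> is constrained. The map makes sense for all radii and all free
  entries, so its derivative can be computed without regard to the boundary of the cones.\<close>

definition "chart_dom = {v. uc v \<in> restr F ` \<Phi>0}"
definition "chart_map v = H_map X G w lam beta0 A K (rc v) (bc v) (s (uc v))"
definition "chart_deriv v =
  sqrt (real CARD('n)) *\<^sub>R (pinv (transpose X) ** M_mat X G w lam A K e (s (uc v)) (T (uc v)))"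

lemma split_coords_eq: "split_coords e A (Kc G A K) F v = ((rc v, bc v), uc v)"
  by (simp add: rc_def bc_def uc_def)

lemma rc_nth: "rc v $ j = (if j \<in> A then v $ inv e (Inl j) else 0)"
  and bc_nth: "bc v $ k = (if k \<in> Kc G A K then v $ inv e (Inr (Inl k)) else 0)"
  and uc_nth: "uc v $ k = (if k \<in> F then v $ inv e (Inr (Inr k)) else 0)"
  by (simp_all add: rc_def bc_def uc_def split_coords_def)

lemma linear_uc: "linear uc"
  by (rule linearI) (simp_all add: vec_eq_iff uc_nth)

lemma uc_coord_space: "uc v \<in> coord_space F"
  by (simp add: coord_space_def uc_nth)

lemma chart_dom_interior: "v \<in> chart_dom \<Longrightarrow> s (uc v) \<in> M_interior X G w A K"
  "v \<in> chart_dom \<Longrightarrow> restr F (s (uc v)) = uc v"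
  using param by (auto simp: chart_dom_def parameterized_def)

lemma s_uc_zero: "v \<in> chart_dom \<Longrightarrow> k \<in> Kc G A K \<Longrightarrow> s (uc v) $ k = 0"
  using chart_dom_interior(1)[of v] in_grp[of k]
  by (auto simp: M_interior_def M_set_def Kc_def in_group_union_iff)

lemma s_uc_nonzero: "v \<in> chart_dom \<Longrightarrow> k \<in> K \<Longrightarrow> s (uc v) $ k \<noteq> 0"
  using chart_dom_interior(1)[of v] by (auto simp: M_interior_def)

text \<open>\<open>s\<close> is differentiable only along \<open>coord_space F\<close>; as
  \<open>uc\<close> takes its values there, the chain rule applies within any
  \<open>D\<close>.\<close>

lemma s_uc_has_derivative:
  assumes "v \<in> chart_dom"
  shows "((\<lambda>v. s (uc v)) has_derivative (\<lambda>d. T (uc v) *v uc d)) (at v within D)"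
proof -
  have "(uc has_derivative uc) (at v within D)"
    by (rule linear_imp_has_derivative[OF linear_uc])
  moreover have "(s has_derivative (*v) (T (uc v))) (at (uc v) within uc ` D)"
  proof (rule has_derivative_subset)
    show "(s has_derivative (*v) (T (uc v))) (at (uc v) within coord_space F)"
      using param assms by (auto simp: parameterized_def C1_with_derivative_def chart_dom_def)
  qed (auto simp: uc_coord_space)
  ultimately show ?thesis
    using diff_chain_within[of uc uc v D s] by (simp add: o_def)
qed

lemma continuous_s_uc: "continuous_on chart_dom (\<lambda>v. s (uc v))"
  using s_uc_has_derivative by (meson differentiable_imp_continuous_on differentiable_on_def differentiable_def)

lemma continuous_T_uc:
  assumes "k \<in> F"
  shows "continuous_on chart_dom (\<lambda>v. column k (T (uc v)))"
proof -
  have "continuous_on (restr F ` \<Phi>0) (\<lambda>u. column k (T u))"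
    using param assms by (auto simp: parameterized_def C1_with_derivative_def)
  moreover have "continuous_on chart_dom uc"
    using linear_continuous_on linear_uc linear_conv_bounded_linear by blast
  ultimately show ?thesis
    by (rule continuous_on_compose2) (auto simp: chart_dom_def)
qed

text \<open>On \<open>K\<close> the argument of \<open>sgn\<close> avoids zero; on the rest of an
  active group it vanishes identically. In inactive groups the sign could jump.\<close>

lemma continuous_sgn_uc:
  assumes "j \<in> A" "k \<in> G j"
  shows "continuous_on chart_dom (\<lambda>v. sgn (s (uc v) $ k))"
proof (cases "k \<in> K")
  case True
  then show ?thesis
    by (intro continuous_on_sgn continuous_on_component continuous_s_uc) (auto simp: s_uc_nonzero)
next
  case False
  then have "k \<in> Kc G A K" using assms by (auto simp: Kc_def group_union_def)
  then have "continuous_on chart_dom (\<lambda>v. sgn (s (uc v) $ k)) \<longleftrightarrow> continuous_on chart_dom (\<lambda>v. 0 :: real)"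
    by (intro continuous_on_cong) (auto simp: s_uc_zero)
  then show ?thesis by simp
qed

lemma continuous_chart_column:
  "continuous_on chart_dom (\<lambda>v. M_column X G w lam A K (s (uc v)) (T (uc v)) (e c))"
proof -
  have lin: "continuous_on chart_dom (\<lambda>v. B *v f v)" if "continuous_on chart_dom f"
    for B :: "real ^ 'p ^ 'p" and f :: "real ^ 'n \<Rightarrow> real ^ 'p"
    using matrix_vector_mult_linear_continuous_on that continuous_on_compose2 by blast
  have restr: "continuous_on chart_dom (\<lambda>v. restr B (f v))" if "\<And>k. k \<in> B \<Longrightarrow> continuous_on chart_dom (\<lambda>v. f v $ k)"
    for B and f :: "real ^ 'n \<Rightarrow> real ^ 'p"
    unfolding restr_def
  proof (rule continuous_on_vec_lambda)
    fix k show "continuous_on chart_dom (\<lambda>v. if k \<in> B then f v $ k else 0)"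
      using that by (cases "k \<in> B") auto
  qed
  \<comment> \<open>Only group columns from \<open>A\<close> and columns of \<open>T\<close> from
    \<open>F\<close> occur, which are those known to vary continuously.\<close>
  have "e c \<in> A <+> (Kc G A K <+> F)" using e by (auto simp: bij_betw_def)
  then consider j where "e c = Inl j" "j \<in> A" | k where "e c = Inr (Inl k)"
    | k where "e c = Inr (Inr k)" "k \<in> F" by auto
  then show ?thesis
  proof cases
    case 1
    then show ?thesis
      by (auto simp: M_column_def sgn_vec_def intro!: lin restr continuous_sgn_uc)
  next
    case 3
    then show ?thesis
      by (auto simp: M_column_def intro!: lin restr continuous_on_scaleR continuous_on_const
          continuous_on_component continuous_T_uc)
  qed (simp add: M_column_def)
qed

lemma continuous_det_chart_deriv: "continuous_on chart_dom (\<lambda>v. det (chart_deriv v))"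
  unfolding det_def chart_deriv_def M_mat_def
  by (auto simp: matrix_matrix_mult_def intro!: continuous_intros continuous_on_component continuous_chart_column)

text \<open>With the signs frozen, \<open>full_beta\<close> is linear in the radii and free entries.
  The sign vector of an active group is supported on \<open>K\<close>, so the two sums do not
  interfere.\<close>

lemma full_beta_columns:
  assumes v: "v \<in> chart_dom"
  shows "full_beta G A K (rc d) (bc d) (s (uc v))
    = (\<Sum>j\<in>A. d $ inv e (Inl j) *\<^sub>R restr (G j) (sgn_vec (s (uc v))))
      + (\<Sum>k\<in>Kc G A K. d $ inv e (Inr (Inl k)) *\<^sub>R axis k 1)"
proof -
  have "full_beta G A K (rc d) (bc d) (s (uc v)) $ k
    = (\<Sum>j\<in>A. d $ inv e (Inl j) * (restr (G j) (sgn_vec (s (uc v))) $ k))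
      + (\<Sum>i\<in>Kc G A K. d $ inv e (Inr (Inl i)) * (axis i 1 $ k))" for k
  proof -
    have "(\<Sum>j\<in>A. d $ inv e (Inl j) * (restr (G j) (sgn_vec (s (uc v))) $ k))
      = (\<Sum>j\<in>A. if j = grp G k then rc d $ grp G k * sgn (s (uc v) $ k) else 0)"
      by (intro sum.cong) (auto simp: restr_nth in_group_iff rc_nth sgn_vec_def)
    also have "\<dots> = (if grp G k \<in> A then rc d $ grp G k * sgn (s (uc v) $ k) else 0)"
      by simp
    finally have 1: "(\<Sum>j\<in>A. d $ inv e (Inl j) * (restr (G j) (sgn_vec (s (uc v))) $ k))
      = (if grp G k \<in> A then rc d $ grp G k * sgn (s (uc v) $ k) else 0)" .
    have 2: "(\<Sum>i\<in>Kc G A K. d $ inv e (Inr (Inl i)) * (axis i 1 $ k)) = bc d $ k"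
      by (simp add: axis_def bc_nth if_distrib cong: if_cong)
    show ?thesis
      unfolding 1 2 using K(1) s_uc_zero[OF v, of k]
      by (auto simp: full_beta_def Kc_def in_group_union_iff bc_nth)
  qed
  then show ?thesis by (simp add: vec_eq_iff)
qed

text \<open>Reads the Jacobian matrix as the differential of H with frozen signs, by expanding the
  product along its three blocks of columns.\<close>

lemma chart_deriv_mult:
  assumes v: "v \<in> chart_dom"
  shows "chart_deriv v *v d = sqrt (real CARD('n)) *\<^sub>R (pinv (transpose X) *v
    (Psi X *v full_beta G A K (rc d) (bc d) (s (uc v))
      + lam *\<^sub>R (weight_mat G w *v restr (- Kc G A K) (T (uc v) *v uc d))))"
proof -
  let ?M = "M_mat X G w lam A K e (s (uc v)) (T (uc v))"
  let ?c = "M_column X G w lam A K (s (uc v)) (T (uc v))"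
  interpret Psi: linear "(*v) (Psi X)" by (rule matrix_vector_mul_linear)
  interpret W: linear "(*v) (weight_mat G w)" by (rule matrix_vector_mul_linear)
  interpret R: linear "restr (- Kc G A K)" by (rule linear_restr)
  have "?M *v d = (\<Sum>i\<in>UNIV. d $ i *\<^sub>R ?c (e i))"
    by (simp add: matrix_vector_mult_def M_mat_def vec_eq_iff mult.commute)
  also have "\<dots> = (\<Sum>j\<in>A. d $ inv e (Inl j) *\<^sub>R (Psi X *v restr (G j) (sgn_vec (s (uc v)))))
    + (\<Sum>k\<in>Kc G A K. d $ inv e (Inr (Inl k)) *\<^sub>R (Psi X *v axis k 1))
    + (\<Sum>k\<in>F. d $ inv e (Inr (Inr k)) *\<^sub>R
        (lam *\<^sub>R (weight_mat G w *v restr (- Kc G A K) (column k (T (uc v))))))"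
    by (subst sum.Plus_betw[OF e]) (auto simp: bij_Plus_inv[OF e] M_column_def matrix_vector_mult_basis intro!: sum.cong arg_cong2[where f="(+)"])
  also have "\<dots> = Psi X *v full_beta G A K (rc d) (bc d) (s (uc v))
    + lam *\<^sub>R (weight_mat G w *v restr (- Kc G A K) (\<Sum>k\<in>F. d $ inv e (Inr (Inr k)) *\<^sub>R column k (T (uc v))))"
    unfolding full_beta_columns[OF v]
    by (simp add: Psi.add Psi.sum Psi.scaleR W.sum W.scaleR R.sum R.scaleR scaleR_sum_right mult.commute)
  also have "(\<Sum>k\<in>F. d $ inv e (Inr (Inr k)) *\<^sub>R column k (T (uc v))) = T (uc v) *v uc d"
  proof -
    have "uc d = restr F (uc d)" by (simp add: vec_eq_iff restr_nth uc_nth)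
    then have "T (uc v) *v uc d = (\<Sum>k\<in>F. uc d $ k *\<^sub>R column k (T (uc v)))"
      by (metis matrix_vector_mult_restr)
    then show ?thesis by (simp add: uc_nth)
  qed
  finally show ?thesis
    by (simp add: chart_deriv_def scaleR_matrix_vector_assoc[symmetric] matrix_vector_mul_assoc[symmetric])
qed

lemma chart_map_has_derivative:
  assumes v: "v \<in> chart_dom"
  shows "(chart_map has_derivative (\<lambda>d. chart_deriv v *v d)) (at v within chart_dom)"
proof -
  let ?fb = "\<lambda>x. full_beta G A K (rc x) (bc x) (s (uc v))"
  let ?L = "\<lambda>x. sqrt (real CARD('n)) *\<^sub>R (pinv (transpose X) *v
    (Psi X *v ?fb x + lam *\<^sub>R (weight_mat G w *v restr (- Kc G A K) (s (uc x))) - Psi X *v beta0))"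
  have linfb: "linear ?fb"
    by (rule linearI) (auto simp: vec_eq_iff full_beta_def rc_nth bc_nth algebra_simps)
  have mv: "((\<lambda>x. B *v f x) has_derivative (\<lambda>d. B *v f' d)) (at v within chart_dom)"
    if "(f has_derivative f') (at v within chart_dom)" for B :: "real ^ 'b ^ 'c" and f f' :: "real ^ 'n \<Rightarrow> real ^ 'b"
    using bounded_linear.has_derivative[OF _ that, of "(*v) B"] by (simp add: matrix_vector_mul_bounded_linear)
  have "((\<lambda>x. restr (- Kc G A K) (s (uc x))) has_derivative (\<lambda>d. restr (- Kc G A K) (T (uc v) *v uc d)))
      (at v within chart_dom)"
    by (rule bounded_linear.has_derivative[OF _ s_uc_has_derivative[OF v]])
      (rule linear_restr[unfolded linear_conv_bounded_linear])
  note sder = mv[OF this, of "weight_mat G w"]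
  have "(?L has_derivative (\<lambda>d. sqrt (real CARD('n)) *\<^sub>R (pinv (transpose X) *v
      (Psi X *v ?fb d + lam *\<^sub>R (weight_mat G w *v restr (- Kc G A K) (T (uc v) *v uc d)) - 0))))
      (at v within chart_dom)"
    by (intro has_derivative_scaleR_right mv has_derivative_diff has_derivative_add has_derivative_const
        linear_imp_has_derivative[OF linfb] sder)
  then have "(?L has_derivative (\<lambda>d. chart_deriv v *v d)) (at v within chart_dom)"
    by (simp add: chart_deriv_mult[OF v])
  \<comment> \<open>The signs of \<open>s\<^sub>K\<close> are locally constant, so \<open>chart_map\<close> agrees near \<open>v\<close> with the map in which they are frozen.\<close>
  moreover have "\<forall>\<^sub>F x in at v within chart_dom. ?L x = chart_map x"
  proof -
    have "\<forall>\<^sub>F x in at v within chart_dom. sgn (s (uc x) $ k) = sgn (s (uc v) $ k)" if "k \<in> K" for k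
    proof -
      have "((\<lambda>x. sgn (s (uc x) $ k)) \<longlongrightarrow> sgn (s (uc v) $ k)) (at v within chart_dom)"
        using continuous_s_uc v s_uc_nonzero[OF v that]
        by (intro tendsto_sgn tendsto_vec_nth) (auto simp: continuous_on)
      \<comment> \<open>Signs are integers, so a distance below one forces equality.\<close>
      then have "\<forall>\<^sub>F x in at v within chart_dom. dist (sgn (s (uc x) $ k)) (sgn (s (uc v) $ k)) < 1"
        by (rule tendstoD) simp
      then show ?thesis
        by eventually_elim (auto simp: sgn_if dist_real_def split: if_splits)
    qed
    then have "\<forall>\<^sub>F x in at v within chart_dom. \<forall>k\<in>K. sgn (s (uc x) $ k) = sgn (s (uc v) $ k)"
      by (simp add: eventually_ball_finite)
    moreover have "\<forall>\<^sub>F x in at v within chart_dom. x \<in> chart_dom"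
      by (simp add: eventually_at_filter)
    ultimately show ?thesis
    proof eventually_elim
      case (elim x)
      have "?fb x = full_beta G A K (rc x) (bc x) (s (uc x))"
        using elim(1) by (simp add: full_beta_def vec_eq_iff)
      moreover have "restr (- Kc G A K) (s (uc x)) = s (uc x)"
        using s_uc_zero[OF elim(2)] by (auto simp: vec_eq_iff restr_nth)
      ultimately show ?case by (simp add: chart_map_def H_map_def)
    qed
  qed
  \<comment> \<open>The filter \<open>at v within chart_dom\<close> excludes \<open>v\<close>, so
    agreement there is checked separately.\<close>
  moreover have "?L v = chart_map v"
  proof -
    have "restr (- Kc G A K) (s (uc v)) = s (uc v)"
      using s_uc_zero[OF v] by (auto simp: vec_eq_iff restr_nth)
    then show ?thesis by (simp add: chart_map_def H_map_def)
  qed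
  ultimately show ?thesis
    by (rule has_derivative_transform_eventually) (use v in simp)
qed

end

context chart
begin

text \<open>With equal \<open>uc\<close> the difference \<open>v - v'\<close> has no
  \<open>F\<close> part, so the derivative at \<open>v\<close> maps it exactly to the difference of
  the images, and the kernel is trivial.\<close>

lemma chart_map_inj:
  assumes v: "v \<in> chart_dom" "v' \<in> chart_dom" and det: "det (chart_deriv v) \<noteq> 0"
    and eq: "uc v = uc v'" "chart_map v = chart_map v'"
  shows "v = v'"
proof -
  let ?n = "sqrt (real CARD('n))" and ?fb = "\<lambda>d. full_beta G A K (rc d) (bc d) (s (uc v))"
  have uc0: "uc (v - v') = 0" using eq(1) linear_diff[OF linear_uc] by simp
  have restr0: "restr B 0 = 0" for B :: "'p set" by (simp add: vec_eq_iff restr_nth)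
  have "?fb (v - v') = ?fb v - ?fb v'"
    by (auto simp: vec_eq_iff full_beta_def rc_nth bc_nth algebra_simps)
  then have "chart_deriv v *v (v - v') = ?n *\<^sub>R (pinv (transpose X) *v (Psi X *v (?fb v - ?fb v')))"
    unfolding chart_deriv_mult[OF v(1)] by (simp add: uc0 restr0)
  also have "\<dots> = chart_map v - chart_map v'"
    unfolding chart_map_def H_map_def eq(1)[symmetric] scaleR_diff_right[symmetric]
      matrix_vector_mult_diff_distrib[symmetric] by (simp add: matrix_vector_mult_diff_distrib)
  finally have "chart_deriv v *v (v - v') = 0" using eq(2) by simp
  then have "v - v' = 0"
    using det by (metis inj_matrix_vector_mult invertible_det_nz injD matrix_vector_mult_0_right)
  then show ?thesis by simp
qed

end

section \<open>The distribution\<close>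

text \<open>Nothing is assumed about measurability of \<open>Q\<close>. A law with a density ignores
  \<open>N\<close>, so the event differs from a measurable one by a subset of a null event.\<close>

lemma emeasure_distributed_almost_equal:
  assumes D: "distributed M L Y f" and B: "B \<in> sets L" and N: "N \<in> null_sets L"
    and Q: "Q \<subseteq> B \<union> N" "B \<subseteq> Q \<union> N"
  shows "{x \<in> space M. Y x \<in> Q} \<in> sets (completion M)"
    and "emeasure (completion M) {x \<in> space M. Y x \<in> Q} = (\<integral>\<^sup>+x. f x * indicator B x \<partial>L)"
proof -
  let ?E = "{x \<in> space M. Y x \<in> Q}" and ?B = "Y -` B \<inter> space M" and ?N = "Y -` N \<inter> space M"
  have Y: "Y \<in> measurable M L" using D by (rule distributed_measurable)
  have Bs: "?B \<in> sets M" using Y B by (rule measurable_sets)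
  have Ns: "N \<in> sets L" using N by auto
  have "emeasure M ?N = (\<integral>\<^sup>+x. f x * indicator N x \<partial>L)"
    by (rule distributed_emeasure[OF D Ns])
  also have "\<dots> = 0"
  proof -
    have "AE x in L. f x * indicator N x = 0"
      using AE_not_in[OF N] by eventually_elim simp
    then have "(\<integral>\<^sup>+x. f x * indicator N x \<partial>L) = (\<integral>\<^sup>+x. 0 \<partial>L)" by (rule nn_integral_cong_AE)
    then show ?thesis by simp
  qed
  finally have Nn: "?N \<in> null_sets M"
    using measurable_sets[OF Y Ns] by (simp add: null_sets_def)
  show E: "?E \<in> sets (completion M)"
  proof (rule sets_completionI[OF _ _ Nn])
    show "?E = (?B - ?N) \<union> (?E \<inter> ?N)" using Q by auto
    show "?B - ?N \<in> sets M" using Bs Nn by auto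
  qed auto
  have "AE x in M. x \<notin> ?N" using Nn by (rule AE_not_in)
  then have "AE x in completion M. x \<notin> ?N" by (rule AE_completion)
  then have "AE x in completion M. x \<in> ?E \<longleftrightarrow> x \<in> ?B"
    using AE_space[of "completion M"] by eventually_elim (use Q in auto)
  then have "emeasure (completion M) ?E = emeasure (completion M) ?B"
    using E Bs by (intro emeasure_eq_AE) auto
  also have "\<dots> = emeasure M ?B" using Bs by (simp add: main_part_sets)
  also have "\<dots> = (\<integral>\<^sup>+x. f x * indicator B x \<partial>L)"
    by (rule distributed_emeasure[OF D B])
  finally show "emeasure (completion M) ?E = (\<integral>\<^sup>+x. f x * indicator B x \<partial>L)" .
qed

text \<open>An affine change scales Lebesgue measure by a nonzero constant. This moves the
  exceptional responses to the scale of the noise.\<close>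

lemma null_sets_affine_preimage:
  fixes t :: "'a::euclidean_space"
  assumes N: "N \<in> null_sets lborel" and c: "c \<noteq> 0"
  shows "(\<lambda>x. t + c *\<^sub>R x) -` N \<in> null_sets lborel"
proof -
  have m: "(\<lambda>x. t + c *\<^sub>R x) \<in> measurable lborel borel"
    by simp
  have Nb: "N \<in> sets borel" using N by auto
  have "emeasure lborel N = (\<integral>\<^sup>+x. ennreal (\<bar>c\<bar> ^ DIM('a)) * indicator N x \<partial>distr lborel borel (\<lambda>x. t + c *\<^sub>R x))"
    using Nb by (subst lborel_affine[OF c, of t], subst emeasure_density) auto
  also have "\<dots> = \<bar>c\<bar> ^ DIM('a) * emeasure lborel ((\<lambda>x. t + c *\<^sub>R x) -` N)"
    using Nb by (subst nn_integral_cmult_indicator) (auto simp: emeasure_distr)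
  finally have "emeasure lborel ((\<lambda>x. t + c *\<^sub>R x) -` N) = 0"
    using N c by (auto simp: null_sets_def ennreal_mult_eq_top_iff)
  then show ?thesis
    using measurable_sets[OF m Nb] by (simp add: null_sets_def)
qed

theorem theorem5p1:
  fixes X :: "real ^ 'p ^ 'n"
    and G :: "'j::finite \<Rightarrow> 'p set"
    and w :: "'j \<Rightarrow> real"
    and lam sigma :: real
    and beta0 :: "real ^ 'p"
    and P :: "'w measure"
    and eps y :: "'w \<Rightarrow> real ^ 'n"
    and g :: "real ^ 'n \<Rightarrow> real"
    and bhat S :: "real ^ 'n \<Rightarrow> real ^ 'p"
    and A :: "'j set" and K F :: "'p set"
    and \<Gamma> :: "((real ^ 'j) \<times> (real ^ 'p)) set"
    and \<Phi>0 \<Delta> :: "(real ^ 'p) set"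
    and s :: "real ^ 'p \<Rightarrow> real ^ 'p"
    and T :: "real ^ 'p \<Rightarrow> real ^ 'p ^ 'p"
    and e :: "'n \<Rightarrow> 'j + 'p + 'p"
  assumes p_ge_n: "CARD('p) \<ge> CARD('n)"
    and groups: "\<And>j. G j \<noteq> {}" "disjoint_family G" "(\<Union>j. G j) = UNIV"
    and weights: "\<And>j. w j > 0"
    and lam: "lam > 0"
    and prob: "prob_space P"
    and eps_rv: "eps \<in> borel_measurable P"
    and eps_indep: "prob_space.indep_vars P (\<lambda>_. borel) (\<lambda>i \<omega>. eps \<omega> $ i) UNIV"
    and eps_ident: "\<And>i i'. distr P borel (\<lambda>\<omega>. eps \<omega> $ i) = distr P borel (\<lambda>\<omega>. eps \<omega> $ i')"
    and eps_mean: "\<And>i. integrable P (\<lambda>\<omega>. eps \<omega> $ i)" "\<And>i. (\<integral>\<omega>. eps \<omega> $ i \<partial>P) = 0"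
    and eps_var: "\<And>i. integrable P (\<lambda>\<omega>. (eps \<omega> $ i)\<^sup>2)" "\<And>i. (\<integral>\<omega>. (eps \<omega> $ i)\<^sup>2 \<partial>P) = sigma\<^sup>2"
    and g_nonneg: "\<And>x. g x \<ge> 0"
    and eps_density:
      "distributed P lborel (\<lambda>\<omega>. (1 / sqrt (real CARD('n))) *\<^sub>R eps \<omega>) (\<lambda>x. ennreal (g x))"
    and y: "\<And>\<omega>. \<omega> \<in> space P \<Longrightarrow> y \<omega> = X *v beta0 + eps \<omega>"
    and general_position:
      "\<And>B. card B = min CARD('n) CARD('p) \<Longrightarrow> columns_independent X B"
    and unique: "AE z in lborel. \<exists>!b. block_lasso_solution X G w lam z b"
    and bhat: "\<And>z. block_lasso_solution X G w lam z (bhat z)"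
    and S: "\<And>z. subgradient_eq X G w lam z (bhat z) (S z)"
    and A: "card A \<le> CARD('n)"
    and K: "K \<in> K_family CARD('n) G A"
    and \<Gamma>: "\<Gamma> \<in> sets borel" "\<Gamma> \<subseteq> cone_prod G A K"
    and param: "parameterized X G w A K F \<Phi>0 s T"
    and \<Delta>: "\<Delta> \<in> sets borel" "\<Delta> \<subseteq> restr F ` \<Phi>0"
    and e: "bij_betw e UNIV (A <+> (Kc G A K <+> F))"
  defines "E \<equiv> {\<omega> \<in> space P.
      (restr A (group_norms G (bhat (y \<omega>))), restr (Kc G A K) (bhat (y \<omega>))) \<in> \<Gamma> \<and>
      S (y \<omega>) \<in> s ` \<Delta> \<and>
      active_groups G (bhat (y \<omega>)) = A \<and>
      active_K G (bhat (y \<omega>)) (S (y \<omega>)) = K}"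
  shows "E \<in> sets (completion P) \<and>
    emeasure (completion P) E =
      (\<integral>\<^sup>+ x \<in> \<Gamma> \<times> \<Delta>. (case x of ((r, b), u) \<Rightarrow>
            ennreal (aug_density g X G w lam beta0 A K e r b (s u) (T u)))
         \<partial>((lborel_on A \<Otimes>\<^sub>M lborel_on (Kc G A K)) \<Otimes>\<^sub>M lborel_on F))"
proof -
  interpret weighted_groups G w
    using groups weights by unfold_locales auto
  have Kprops: "K \<subseteq> group_union G A" "\<And>j. j \<in> A \<Longrightarrow> K \<inter> G j \<noteq> {}"
    using K by (auto simp: K_family_def)
  interpret chart G w X lam beta0 A K F \<Phi>0 s T e
    using Kprops param e by unfold_locales auto
  let ?n = "real CARD('n)" and ?C = "Kc G A K"
  have inj: "v = 0" if "transpose X *v v = 0" for v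
    using general_position_transpose_inj[OF p_ge_n _ that] general_position p_ge_n by (simp add: min_def)
  let ?Y = "\<lambda>\<omega>. (1 / sqrt ?n) *\<^sub>R eps \<omega>" and ?z = "\<lambda>x. X *v beta0 + sqrt ?n *\<^sub>R x"
  \<comment> \<open>The event as a set of values \<open>x\<close> of the scaled noise, which has
    density \<open>g\<close>; the response belonging to \<open>x\<close> is
    \<open>?z x\<close>.\<close>
  define Q where "Q = {x.
      (restr A (group_norms G (bhat (?z x))), restr ?C (bhat (?z x))) \<in> \<Gamma> \<and> S (?z x) \<in> s ` \<Delta> \<and>
      active_groups G (bhat (?z x)) = A \<and> active_K G (bhat (?z x)) (S (?z x)) = K}"
  define D where "D = split_coords e A ?C F -` (\<Gamma> \<times> \<Delta>)"
  have E_Q: "E = {\<omega> \<in> space P. ?Y \<omega> \<in> Q}"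
    unfolding E_def Q_def by (auto simp: y)
  have D_borel: "D \<in> sets borel"
  proof -
    have "\<Gamma> \<times> \<Delta> \<in> sets borel"
      using \<Gamma>(1) \<Delta>(1) by (simp add: borel_prod[symmetric] pair_measureI)
    then show ?thesis
      unfolding D_def using measurable_sets[OF borel_measurable_split_coords] by simp
  qed
  have D_iff: "v \<in> D \<longleftrightarrow> (rc v, bc v) \<in> \<Gamma> \<and> uc v \<in> \<Delta>" for v
    by (simp add: D_def split_coords_eq)
  have D_dom: "D \<subseteq> chart_dom"
    using \<Delta>(2) by (auto simp: D_iff chart_dom_def)
  have kkt: "kkt X G w lam (?z (chart_map v)) (full_beta G A K (rc v) (bc v) (s (uc v))) (s (uc v))"
    if "v \<in> D" for v
  proof -
    have s: "s (uc v) \<in> M_interior X G w A K" and rb: "(rc v, bc v) \<in> cone_prod G A K"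
      using that D_dom chart_dom_interior(1) \<Gamma>(2) by (auto simp: D_iff)
    then have "s (uc v) \<in> row_space_V X G w" by (simp add: M_interior_def M_set_def)
    from full_beta_kkt[OF Kprops s rb subgradient_eq_H_map[OF inj this]]
    show ?thesis unfolding chart_map_def .
  qed
  \<comment> \<open>This inclusion has no exceptional set: the solution and its subgradient supply
    the coordinates, and \<open>H_map_eq\<close> returns \<open>x\<close>.\<close>
  have Q_sub: "Q \<subseteq> chart_map ` D"
  proof
    fix x assume x: "x \<in> Q"
    let ?b = "bhat (?z x)"
    let ?r = "restr A (group_norms G ?b)" and ?c = "restr ?C ?b"
    from x obtain u where u: "u \<in> \<Delta>" "S (?z x) = s u" and rc: "(?r, ?c) \<in> \<Gamma>"
      and act: "active_groups G ?b = A" "active_K G ?b (s u) = K"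
      by (auto simp: Q_def)
    have "kkt X G w lam (?z x) ?b (s u)"
      using solution_imp_kkt[OF bhat S lam weights] u(2) by metis
    from full_beta_of_kkt[OF this act] have fb: "full_beta G A K ?r ?c (s u) = ?b" .
    have "subgradient_eq X G w lam (?z x) (full_beta G A K ?r ?c (s u)) (s u)"
      unfolding fb using S[of "?z x"] u(2) by simp
    from H_map_eq[OF inj this] have H: "H_map X G w lam beta0 A K ?r ?c (s u) = x"
      by simp
    \<comment> \<open>Needed because splitting undoes joining only on the coordinate
      subspaces.\<close>
    have "u \<in> coord_space F" using u(1) \<Delta>(2) by (auto simp: coord_space_def restr_nth)
    then have "split_coords e A ?C F (join_coords e ((?r, ?c), u)) = ((?r, ?c), u)"
      using rc \<Gamma>(2) by (intro split_join_coords e) (auto simp: cone_prod_def)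
    then have v: "rc (join_coords e ((?r, ?c), u)) = ?r" "bc (join_coords e ((?r, ?c), u)) = ?c"
      "uc (join_coords e ((?r, ?c), u)) = u"
      by (simp_all add: split_coords_eq)
    then have "join_coords e ((?r, ?c), u) \<in> D" "chart_map (join_coords e ((?r, ?c), u)) = x"
      using rc u(1) H by (simp_all add: D_iff chart_map_def)
    then show "x \<in> chart_map ` D" by (metis image_eqI)
  qed
  obtain N0 where N0: "{z. \<not> (\<exists>!b. block_lasso_solution X G w lam z b)} \<subseteq> N0" "N0 \<in> null_sets lborel"
    using unique by (auto elim!: AE_E simp: null_sets_def)
  define N1 where "N1 = ?z -` N0"
  have N1: "N1 \<in> null_sets lborel"
    unfolding N1_def using N0(2) by (rule null_sets_affine_preimage) simp
  have sub_Q: "chart_map ` D \<subseteq> Q \<union> N1"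
  proof
    fix x assume "x \<in> chart_map ` D"
    then obtain v where v: "v \<in> D" and x: "x = chart_map v" by blast
    let ?fb = "full_beta G A K (rc v) (bc v) (s (uc v))"
    have s: "s (uc v) \<in> M_interior X G w A K" and rb: "(rc v, bc v) \<in> cone_prod G A K"
      using v D_dom chart_dom_interior(1) \<Gamma>(2) by (auto simp: D_iff)
    show "x \<in> Q \<union> N1"
    proof (cases "\<exists>!b. block_lasso_solution X G w lam (?z x) b")
      case True
      \<comment> \<open>Both vectors solve the problem at \<open>?z x\<close>, so uniqueness
        identifies them; the subgradients agree by monotonicity alone.\<close>
      have "bhat (?z x) = ?fb"
        using True bhat kkt_imp_solution[OF kkt[OF v] lam] x by blast
      moreover have "S (?z x) = s (uc v)"
        using kkt_subgradient_unique[OF solution_imp_kkt[OF bhat S lam weights] kkt[OF v] lam weights] x by simp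
      ultimately have "x \<in> Q"
        using v full_beta_representation[OF Kprops s rb] by (auto simp: Q_def D_iff)
      then show ?thesis by simp
    next
      case False
      then show ?thesis using N0(1) by (auto simp: N1_def)
    qed
  qed
  \<comment> \<open>Equal images are equal responses, hence have equal subgradients and, after
    \<open>restr F\<close>, equal \<open>uc\<close>; \<open>chart_map_inj\<close> settles the other
    coordinates.\<close>
  have inj_D: "inj_on chart_map {v \<in> D. det (chart_deriv v) \<noteq> 0}"
  proof (rule inj_onI)
    fix v v' assume v: "v \<in> {v \<in> D. det (chart_deriv v) \<noteq> 0}" and v': "v' \<in> {v \<in> D. det (chart_deriv v) \<noteq> 0}"
      and eq: "chart_map v = chart_map v'"
    have vD: "v \<in> D" "v' \<in> D" and det: "det (chart_deriv v) \<noteq> 0" using v v' by simp_all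
    then have dom: "v \<in> chart_dom" "v' \<in> chart_dom" using D_dom by blast+
    have s_eq: "s (uc v) = s (uc v')"
      by (rule kkt_subgradient_unique[OF kkt[OF vD(1)] kkt[OF vD(2), folded eq] lam weights])
    have "uc v = restr F (s (uc v))" by (rule chart_dom_interior(2)[OF dom(1), symmetric])
    also have "\<dots> = uc v'" unfolding s_eq by (rule chart_dom_interior(2)[OF dom(2)])
    finally show "v = v'"
      by (rule chart_map_inj[OF dom det _ eq])
  qed
  have detm: "(\<lambda>v. indicator D v * \<bar>det (chart_deriv v)\<bar>) \<in> borel_measurable borel"
    using borel_measurable_continuous_on_indicator[OF D_borel, of "\<lambda>v. \<bar>det (chart_deriv v)\<bar>"]
      continuous_on_subset[OF continuous_det_chart_deriv D_dom]
    by (simp add: continuous_on_rabs)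
  have der: "(chart_map has_derivative (\<lambda>d. chart_deriv v *v d)) (at v within D)" if "v \<in> D" for v
    using chart_map_has_derivative[of v] that D_dom by (meson has_derivative_subset subsetD)
  have gm: "g \<in> borel_measurable borel"
    using distributed_real_measurable[OF _ eps_density] g_nonneg by simp
  have g_int: "integrable lborel g"
  proof (rule integrableI_nonneg)
    have "(\<integral>\<^sup>+x. ennreal (g x) \<partial>lborel) = emeasure P (space P)"
      using distributed_emeasure[OF eps_density, of UNIV] by simp
    then show "(\<integral>\<^sup>+x. ennreal (g x) \<partial>lborel) < \<infinity>"
      using prob_space.emeasure_space_1[OF prob] by simp
  qed (use gm g_nonneg in auto)
  have "\<exists>B N. B \<in> sets borel \<and> N \<in> null_sets lborel \<and> chart_map ` D \<subseteq> B \<union> N \<and> B \<subseteq> chart_map ` D \<union> N \<and>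
    (\<integral>\<^sup>+x. ennreal (g x) * indicator B x \<partial>lborel)
      = (\<integral>\<^sup>+v. ennreal (g (chart_map v) * \<bar>det (chart_deriv v)\<bar>) * indicator D v \<partial>lborel)"
    by (rule change_of_variables_image[OF D_borel _ detm inj_D g_int g_nonneg]) (rule der)
  then obtain B N2 where B: "B \<in> sets borel" "N2 \<in> null_sets lborel"
    "chart_map ` D \<subseteq> B \<union> N2" "B \<subseteq> chart_map ` D \<union> N2"
    and int: "(\<integral>\<^sup>+x. ennreal (g x) * indicator B x \<partial>lborel)
      = (\<integral>\<^sup>+v. ennreal (g (chart_map v) * \<bar>det (chart_deriv v)\<bar>) * indicator D v \<partial>lborel)"
    by (elim exE conjE)
  have "B \<in> sets lborel" using B by simp
  \<comment> \<open>\<open>N1\<close> collects the noise values with a non-unique problem,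
    \<open>N2\<close> the error of the change of variables.\<close>
  moreover have "N1 \<union> N2 \<in> null_sets lborel" using N1 B(2) by (rule null_sets.Un)
  moreover have "Q \<subseteq> B \<union> (N1 \<union> N2)" using subset_trans[OF Q_sub B(3)] by blast
  moreover have "B \<subseteq> Q \<union> (N1 \<union> N2)" using subset_trans[OF B(4) Un_mono[OF sub_Q subset_refl]] by (simp add: Un_assoc)
  ultimately have E: "E \<in> sets (completion P)"
    "emeasure (completion P) E = (\<integral>\<^sup>+x. ennreal (g x) * indicator B x \<partial>lborel)"
    unfolding E_Q by (rule emeasure_distributed_almost_equal[OF eps_density])+
  let ?f = "\<lambda>x. (case x of ((r, b), u) \<Rightarrow>
      ennreal (aug_density g X G w lam beta0 A K e r b (s u) (T u))) * indicator (\<Gamma> \<times> \<Delta>) x"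
  have f_split: "?f (split_coords e A ?C F v)
      = ennreal (g (chart_map v) * \<bar>det (chart_deriv v)\<bar>) * indicator D v" for v
    by (simp add: split_coords_eq aug_density_def jacobian_def chart_map_def chart_deriv_def D_iff indicator_def)
  have cont: "continuous_on D chart_map"
    using der by (meson differentiable_imp_continuous_on differentiable_on_def differentiable_def)
  \<comment> \<open>\<open>s\<close> and \<open>T\<close> are arbitrary off the chart. The indicator
    of \<open>D\<close> confines the integrand to where the map and its determinant are
    continuous.\<close>
  have "(\<lambda>v. ?f (split_coords e A ?C F v)) \<in> borel_measurable borel"
    unfolding f_split using borel_measurable_transformed_density[OF D_borel cont detm gm] .
  from nn_integral_split_coords[OF e this] show ?thesis
    using E by (simp add: f_split int)
qed

end
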